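(* Let $\mathcal F$ be an irrational homogeneous iterated function system on $\mathbb R^2$ satisfying the open set condition, with limit set $\mathcal K$. Let $\mu$ be the restriction of the $s$-dimensional Hausdorff measure to $\mathcal K$, where $s=\dim_H(\mathcal K)$. Then, for Lebesgue almost every $\pi_\theta\in\mathrm{Gr}(2,1)$, $$\alpha_1(\mu)=\inf_{\pi_\beta\in\mathrm{Gr}(2,1)}\dim_\infty\big((\pi_\beta)_*\mu\big)=\dim_\infty\big((\pi_\theta)_*\mu\big).$$
   Context: **IFS.** A homogeneous IFS on $\mathbb R^2$ is a finite collection $\mathcal F=\{h_i:i\in\Lambda\}$ of maps $h_i(\mathbf x)=\rho R_\alpha\mathbf x+b_i$, where $b_i\in\mathbb R^2$, $0<\rho<1$, and $R_\alpha$ is the rotation by angle $\alpha$, with $\rho$ and $\alpha$ independent of $i$. It is irrational if $\alpha\notin\mathbb Q\pi$. Its limit set is the unique nonempty compact set $\mathcal K$ with $\mathcal K=\bigcup_{i}h_i(\mathcal K)$. $\mathcal F$ satisfies the open set condition if there is a nonempty open $U\subset\mathbb R^2$ with $h_i(U)\subseteq U$ for all $i$ and $h_i(U)\cap h_j(U)=\emptyset$ for all $i\ne j$. **Exponents.** $\mathrm{Gr}(2,1)$ is the Grassmannian of lines through $0$ in $\mathbb R^2$; $\pi_\theta$ is the line in direction $(\cos\theta,\sin\theta)$, identified with the orthogonal projection of $\mathbb R^2$ onto it (and the line is identified isometrically with $\mathbb R$). $(\pi_\theta)_*\mu$ is the push-forward measure. For a finite Borel measure $\nu$ on $\mathbb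 R^\ell$, the Frostman exponent is $$\dim_\infty(\nu)=\liminf_{\varepsilon\to0}\frac{\log\sup_{x\in\mathbb R^\ell}\nu(B(x,\varepsilon))}{\log\varepsilon}.$$ With $\mathcal A(2,1)$ the set of affine lines in $\mathbb R^2$ and $\mathcal L^{(\varepsilon)}$ the open Euclidean $\varepsilon$-neighborhood of $\mathcal L$, $$\alpha_1(\mu)=\liminf_{\varepsilon\to0}\frac{\log\sup_{\mathcal L\in\mathcal A(2,1)}\mu(\mathcal L^{(\varepsilon)})}{\log\varepsilon}.$$ *)

theory Defs
  imports "HOL-Analysis.Analysis"
begin

section \<open>Hausdorff measure and Hausdorff dimension\<close>

text \<open>
  The value \<open>diam(U)\<^sup>s\<close>, with \<open>diam({})\<^sup>s = 0\<close> and \<open>diam({x})\<^sup>0 = 1\<close>, so that the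
  \<open>0\<close>-dimensional measure is counting measure. The case \<open>s = 0\<close> is separate because
  \<open>0 powr 0 = 0\<close> in HOL.
\<close>

definition diam_powr :: "real \<Rightarrow> 'a::metric_space set \<Rightarrow> ennreal" where
  "diam_powr s U =
     (if U = {} then 0 else if s = 0 then 1 else ennreal (diameter U powr s))"

text \<open>
  Covers must consist of bounded sets, since the library's \<^const>\<open>diameter\<close> is
  meaningful only for those.
\<close>

definition hausdorff_covers :: "real \<Rightarrow> 'a::metric_space set \<Rightarrow> (nat \<Rightarrow> 'a set) set" where
  "hausdorff_covers \<delta> A =
     {U. A \<subseteq> (\<Union>i. U i) \<and> (\<forall>i. bounded (U i) \<and> diameter (U i) \<le> \<delta>)}"

definition hausdorff_premeasure :: "real \<Rightarrow> real \<Rightarrow> 'a::metric_space set \<Rightarrow> ennreal" where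
  "hausdorff_premeasure s \<delta> A = (INF U\<in>hausdorff_covers \<delta> A. \<Sum>i. diam_powr s (U i))"

definition hausdorff_outer_measure :: "real \<Rightarrow> 'a::metric_space set \<Rightarrow> ennreal" where
  "hausdorff_outer_measure s A = (SUP \<delta>\<in>{0<..}. hausdorff_premeasure s \<delta> A)"

text \<open>
  \<^const>\<open>measure_of\<close> yields the zero measure when the given set function is not a measure on
  the sigma-algebra; the lemma \<open>emeasure_hausdorff_measure\<close> below shows that this does not
  happen here. No normalising constant is included.
\<close>

definition hausdorff_measure :: "real \<Rightarrow> 'a::metric_space measure" where
  "hausdorff_measure s = measure_of UNIV (sets borel) (hausdorff_outer_measure s)"

text \<open>
  In a Euclidean space the set below is never empty (it contains every \<open>s > DIM('a)\<close>), so the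
  real-valued infimum is the usual one.
\<close>

definition hausdorff_dim :: "'a::euclidean_space set \<Rightarrow> real" where
  "hausdorff_dim A = Inf {s. 0 \<le> s \<and> hausdorff_outer_measure s A = 0}"


subsection \<open>The Hausdorff measure is a Borel measure\<close>

lemma diam_powr_empty [simp]: "diam_powr s {} = 0"
  by (simp add: diam_powr_def)

lemma hausdorff_premeasure_empty:
  assumes "0 < \<delta>"
  shows "hausdorff_premeasure s \<delta> {} = 0"
proof -
  have "(\<lambda>_. {}) \<in> hausdorff_covers \<delta> ({} :: 'a set)"
    using assms by (simp add: hausdorff_covers_def)
  then have "hausdorff_premeasure s \<delta> ({} :: 'a set) \<le> (\<Sum>i. diam_powr s ({} :: 'a set))"
    unfolding hausdorff_premeasure_def by (rule INF_lower2) simp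
  then show ?thesis by simp
qed

lemma hausdorff_premeasure_mono:
  "A \<subseteq> B \<Longrightarrow> hausdorff_premeasure s \<delta> A \<le> hausdorff_premeasure s \<delta> B"
  unfolding hausdorff_premeasure_def hausdorff_covers_def
  by (rule INF_superset_mono) auto

lemma hausdorff_premeasure_antimono:
  "\<delta> \<le> \<epsilon> \<Longrightarrow> hausdorff_premeasure s \<epsilon> A \<le> hausdorff_premeasure s \<delta> A"
  unfolding hausdorff_premeasure_def hausdorff_covers_def
  by (rule INF_superset_mono) (auto intro: order_trans)

lemma hausdorff_premeasure_UN_le:
  fixes A :: "nat \<Rightarrow> 'a::metric_space set"
  shows "hausdorff_premeasure s \<delta> (\<Union>n. A n) \<le> (\<Sum>n. hausdorff_premeasure s \<delta> (A n))"
proof (rule ennreal_le_epsilon)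
  fix e :: real
  assume e: "0 < e" and fin: "(\<Sum>n. hausdorff_premeasure s \<delta> (A n)) < top"
  have lt: "hausdorff_premeasure s \<delta> (A n)
      < hausdorff_premeasure s \<delta> (A n) + e * (1/2) ^ Suc n" for n
    using fin e by (auto simp add: less_top dest!: ennreal_suminf_lessD)
  have "\<exists>U\<in>hausdorff_covers \<delta> (A n).
      (\<Sum>i. diam_powr s (U i)) \<le> hausdorff_premeasure s \<delta> (A n) + e * (1/2) ^ Suc n" for n
  proof -
    obtain U where "U \<in> hausdorff_covers \<delta> (A n)"
      "(\<Sum>i. diam_powr s (U i)) < hausdorff_premeasure s \<delta> (A n) + e * (1/2) ^ Suc n"
      using lt[of n] unfolding hausdorff_premeasure_def[of s \<delta> "A n"]
      by (auto simp: INF_less_iff simp del: power_Suc)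
    then show ?thesis by (blast intro: less_imp_le)
  qed
  then obtain U where U: "\<And>n. U n \<in> hausdorff_covers \<delta> (A n)"
    and Ule: "\<And>n. (\<Sum>i. diam_powr s (U n i))
                \<le> hausdorff_premeasure s \<delta> (A n) + e * (1/2) ^ Suc n"
    by metis
  define V where "V k = (case prod_decode k of (n, i) \<Rightarrow> U n i)" for k
  have V: "V \<in> hausdorff_covers \<delta> (\<Union>n. A n)"
    unfolding hausdorff_covers_def
  proof (intro CollectI conjI allI)
    show "(\<Union>n. A n) \<subseteq> (\<Union>k. V k)"
    proof
      fix x assume "x \<in> (\<Union>n. A n)"
      then obtain n where "x \<in> A n" by auto
      with U[of n] obtain i where "x \<in> U n i"
        by (auto simp: hausdorff_covers_def)
      then have "x \<in> V (prod_encode (n, i))" by (simp add: V_def)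
      then show "x \<in> (\<Union>k. V k)" by blast
    qed
    show "bounded (V k)" "diameter (V k) \<le> \<delta>" for k
      using U by (auto simp: hausdorff_covers_def V_def split: prod.split)
  qed
  have "hausdorff_premeasure s \<delta> (\<Union>n. A n) \<le> (\<Sum>k. diam_powr s (V k))"
    unfolding hausdorff_premeasure_def by (rule INF_lower[OF V])
  also have "\<dots> = (\<Sum>k. (case_prod (\<lambda>n i. diam_powr s (U n i))) (prod_decode k))"
    by (simp add: V_def case_prod_unfold)
  also have "\<dots> = (\<Sum>n. \<Sum>i. diam_powr s (U n i))"
    by (rule suminf_ennreal_2dimen) simp
  also have "\<dots> \<le> (\<Sum>n. hausdorff_premeasure s \<delta> (A n) + e * (1/2) ^ Suc n)"
    by (intro suminf_le Ule) auto
  also have "\<dots> = (\<Sum>n. hausdorff_premeasure s \<delta> (A n))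
      + (\<Sum>n. ennreal e * ennreal ((1/2) ^ Suc n))"
    using e by (subst suminf_add[symmetric])
      (auto simp del: ennreal_suminf_cmult simp add: ennreal_mult[symmetric])
  also have "\<dots> = (\<Sum>n. hausdorff_premeasure s \<delta> (A n)) + e"
    unfolding ennreal_suminf_cmult
    by (subst suminf_ennreal_eq[OF zero_le_power power_half_series]) auto
  finally show "hausdorff_premeasure s \<delta> (\<Union>n. A n)
      \<le> (\<Sum>n. hausdorff_premeasure s \<delta> (A n)) + e" .
qed

lemma hausdorff_outer_measure_empty [simp]: "hausdorff_outer_measure s {} = 0"
  unfolding hausdorff_outer_measure_def
  by (rule antisym) (auto intro!: SUP_least simp: hausdorff_premeasure_empty)

lemma hausdorff_outer_measure_mono:
  "A \<subseteq> B \<Longrightarrow> hausdorff_outer_measure s A \<le> hausdorff_outer_measure s B"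
  unfolding hausdorff_outer_measure_def
  by (intro SUP_mono) (auto intro: hausdorff_premeasure_mono)

lemma hausdorff_outer_measure_UN_le:
  "hausdorff_outer_measure s (\<Union>n. A n) \<le> (\<Sum>n. hausdorff_outer_measure s (A n))"
  unfolding hausdorff_outer_measure_def[of s "\<Union>n. A n"]
proof (rule SUP_least)
  fix \<delta> :: real assume \<delta>: "\<delta> \<in> {0<..}"
  have "hausdorff_premeasure s \<delta> (\<Union>n. A n) \<le> (\<Sum>n. hausdorff_premeasure s \<delta> (A n))"
    by (rule hausdorff_premeasure_UN_le)
  also have "\<dots> \<le> (\<Sum>n. hausdorff_outer_measure s (A n))"
    unfolding hausdorff_outer_measure_def using \<delta>
    by (intro suminf_le SUP_upper) auto
  finally show "hausdorff_premeasure s \<delta> (\<Union>n. A n)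
      \<le> (\<Sum>n. hausdorff_outer_measure s (A n))" .
qed

lemma outer_measure_space_hausdorff:
  "outer_measure_space UNIV (hausdorff_outer_measure s)"
  unfolding outer_measure_space_def positive_def increasing_def countably_subadditive_def
  by (auto intro: hausdorff_outer_measure_mono hausdorff_outer_measure_UN_le)

lemma hausdorff_outer_measure_Un_le:
  "hausdorff_outer_measure s (A \<union> B) \<le> hausdorff_outer_measure s A + hausdorff_outer_measure s B"
proof -
  have "hausdorff_outer_measure s (\<Union>n. binaryset A B n)
      \<le> (\<Sum>n. hausdorff_outer_measure s (binaryset A B n))"
    by (rule hausdorff_outer_measure_UN_le)
  also have "\<dots> = hausdorff_outer_measure s A + hausdorff_outer_measure s B"
    by (rule suminf_binaryset_eq) simp
  finally show ?thesis by (simp add: UN_binaryset_eq)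
qed

lemma hausdorff_premeasure_separated:
  fixes A B :: "'a::metric_space set"
  assumes sep: "\<And>x y. x \<in> A \<Longrightarrow> y \<in> B \<Longrightarrow> d \<le> dist x y" and "\<delta> < d" "0 < \<delta>"
  shows "hausdorff_premeasure s \<delta> A + hausdorff_premeasure s \<delta> B
          \<le> hausdorff_premeasure s \<delta> (A \<union> B)"
  unfolding hausdorff_premeasure_def[of s \<delta> "A \<union> B"]
proof (rule INF_greatest)
  fix U assume U: "U \<in> hausdorff_covers \<delta> (A \<union> B)"
  define V where "V i = (if U i \<inter> A = {} then {} else U i)" for i
  define W where "W i = (if U i \<inter> B = {} then {} else U i)" for i
  have V: "V \<in> hausdorff_covers \<delta> A" and W: "W \<in> hausdorff_covers \<delta> B"
    using U \<open>0 < \<delta>\<close> by (fastforce simp: hausdorff_covers_def V_def W_def)+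
  have disj: "U i \<inter> A = {} \<or> U i \<inter> B = {}" for i
  proof (rule ccontr)
    assume "\<not> ?thesis"
    then obtain x y where xy: "x \<in> U i" "x \<in> A" "y \<in> U i" "y \<in> B" by auto
    have "dist x y \<le> diameter (U i)"
      using U xy by (intro diameter_bounded_bound) (auto simp: hausdorff_covers_def)
    also have "\<dots> \<le> \<delta>"
      using U by (auto simp: hausdorff_covers_def)
    finally show False
      using sep[OF xy(2) xy(4)] \<open>\<delta> < d\<close> by simp
  qed
  have "hausdorff_premeasure s \<delta> A + hausdorff_premeasure s \<delta> B
      \<le> (\<Sum>i. diam_powr s (V i)) + (\<Sum>i. diam_powr s (W i))"
    unfolding hausdorff_premeasure_def
    by (intro add_mono INF_lower V W)
  also have "\<dots> = (\<Sum>i. diam_powr s (V i) + diam_powr s (W i))"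
    by (rule suminf_add) auto
  also have "\<dots> \<le> (\<Sum>i. diam_powr s (U i))"
    using disj by (intro suminf_le) (auto simp: V_def W_def)
  finally show "hausdorff_premeasure s \<delta> A + hausdorff_premeasure s \<delta> B
      \<le> (\<Sum>i. diam_powr s (U i))" .
qed

lemma hausdorff_outer_measure_separated:
  fixes A B :: "'a::metric_space set"
  assumes sep: "\<And>x y. x \<in> A \<Longrightarrow> y \<in> B \<Longrightarrow> d \<le> dist x y" and "0 < d"
  shows "hausdorff_outer_measure s A + hausdorff_outer_measure s B
          \<le> hausdorff_outer_measure s (A \<union> B)"
proof -
  have "hausdorff_outer_measure s A + hausdorff_outer_measure s B
      = (SUP \<delta>\<in>{0<..}. hausdorff_premeasure s \<delta> A + hausdorff_premeasure s \<delta> B)"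
    unfolding hausdorff_outer_measure_def
  proof (rule SUP_add_directed_ennreal[symmetric])
    fix \<delta> \<epsilon> :: real assume "\<delta> \<in> {0<..}" "\<epsilon> \<in> {0<..}"
    then show "\<exists>k\<in>{0<..}. hausdorff_premeasure s \<delta> A + hausdorff_premeasure s \<epsilon> B
        \<le> hausdorff_premeasure s k A + hausdorff_premeasure s k B"
      by (intro bexI[of _ "min \<delta> \<epsilon>"] add_mono hausdorff_premeasure_antimono) auto
  qed
  also have "\<dots> \<le> hausdorff_outer_measure s (A \<union> B)"
  proof (rule SUP_least)
    fix \<delta> :: real assume \<delta>: "\<delta> \<in> {0<..}"
    define \<epsilon> where "\<epsilon> = min \<delta> (d / 2)"
    have \<epsilon>: "0 < \<epsilon>" "\<epsilon> < d" "\<epsilon> \<le> \<delta>" using \<delta> \<open>0 < d\<close> by (auto simp: \<epsilon>_def)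
    have "hausdorff_premeasure s \<delta> A + hausdorff_premeasure s \<delta> B
        \<le> hausdorff_premeasure s \<epsilon> A + hausdorff_premeasure s \<epsilon> B"
      by (intro add_mono hausdorff_premeasure_antimono \<epsilon>)
    also have "\<dots> \<le> hausdorff_premeasure s \<epsilon> (A \<union> B)"
      using sep \<epsilon> by (intro hausdorff_premeasure_separated[of _ _ d])
    also have "\<dots> \<le> hausdorff_outer_measure s (A \<union> B)"
      unfolding hausdorff_outer_measure_def using \<epsilon> by (intro SUP_upper) auto
    finally show "hausdorff_premeasure s \<delta> A + hausdorff_premeasure s \<delta> B
        \<le> hausdorff_outer_measure s (A \<union> B)" .
  qed
  finally show ?thesis .
qed

lemma hausdorff_outer_measure_separated_sum:
  fixes R :: "nat \<Rightarrow> 'a::metric_space set"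
  assumes sep: "\<And>i j. i < j \<Longrightarrow> j < N \<Longrightarrow> \<exists>d>0. \<forall>x\<in>R i. \<forall>y\<in>R j. d \<le> dist x y"
  shows "(\<Sum>i<N. hausdorff_outer_measure s (R i)) \<le> hausdorff_outer_measure s (\<Union>i<N. R i)"
  using assms
proof (induction N)
  case 0
  then show ?case by simp
next
  case (Suc N)
  have "\<forall>i<N. \<exists>d>0. \<forall>x\<in>R i. \<forall>y\<in>R N. d \<le> dist x y"
    using Suc.prems by auto
  then obtain D where D: "\<And>i. i < N \<Longrightarrow> 0 < D i"
    "\<And>i x y. i < N \<Longrightarrow> x \<in> R i \<Longrightarrow> y \<in> R N \<Longrightarrow> D i \<le> dist x y"
    by metis
  define d where "d = Min (insert 1 (D ` {..<N}))"
  have d: "0 < d" "\<And>i. i < N \<Longrightarrow> d \<le> D i"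
    using D(1) by (auto simp: d_def)
  have "(\<Sum>i<Suc N. hausdorff_outer_measure s (R i))
      \<le> hausdorff_outer_measure s (\<Union>i<N. R i) + hausdorff_outer_measure s (R N)"
    using Suc by simp
  also have "\<dots> \<le> hausdorff_outer_measure s ((\<Union>i<N. R i) \<union> R N)"
  proof (rule hausdorff_outer_measure_separated[OF _ d(1)])
    fix x y assume "x \<in> (\<Union>i<N. R i)" "y \<in> R N"
    then obtain i where "i < N" "x \<in> R i" by auto
    then show "d \<le> dist x y"
      using d(2)[of i] D(2)[of i x y] \<open>y \<in> R N\<close> by simp
  qed
  also have "(\<Union>i<N. R i) \<union> R N = (\<Union>i<Suc N. R i)"
    by (auto simp: less_Suc_eq)
  finally show ?case .
qed

lemma hausdorff_outer_measure_split_closed: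
  fixes C A :: "'a::metric_space set"
  assumes C: "closed C"
  shows "hausdorff_outer_measure s (A \<inter> C) + hausdorff_outer_measure s (A - C)
          \<le> hausdorff_outer_measure s A"
proof (cases "C = {} \<or> hausdorff_outer_measure s A = top")
  case True
  then show ?thesis by auto
next
  case False
  let ?H = "hausdorff_outer_measure s :: 'a set \<Rightarrow> ennreal"
  let ?d = "\<lambda>x. infdist x C"
  have finA: "?H A < top" using False by (simp add: less_top)
  define r where "r n = 1 / real (Suc n)" for n
  have r_pos: "0 < r n" and r_less: "m < n \<Longrightarrow> r n < r m" for m n
    by (auto simp: r_def field_simps)
  have r_small: "\<exists>n. r n < e" if "0 < e" for e
    using reals_Archimedean[OF that] by (auto simp: r_def inverse_eq_divide)
  define S where "S n = {x\<in>A. r n \<le> ?d x}" for n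
  define R where "R n = {x\<in>A. r (Suc n) \<le> ?d x \<and> ?d x < r n}" for n
  have sepR: "\<exists>d>0. \<forall>x\<in>R i. \<forall>y\<in>R j. d \<le> dist x y" if "Suc i < j" for i j
  proof (intro exI conjI ballI)
    show "0 < r (Suc i) - r j" using r_less[OF that] by simp
    fix x y assume "x \<in> R i" "y \<in> R j"
    moreover have "?d x \<le> ?d y + dist x y" by (rule infdist_triangle)
    ultimately show "r (Suc i) - r j \<le> dist x y" by (auto simp: R_def)
  qed
  have sum_part: "(\<Sum>i. ?H (R (2 * i + k))) \<le> ?H A" for k
  proof (rule suminf_le_const)
    fix N
    have "(\<Sum>i<N. ?H (R (2 * i + k))) \<le> ?H (\<Union>i<N. R (2 * i + k))"
      by (rule hausdorff_outer_measure_separated_sum) (auto intro!: sepR)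
    also have "\<dots> \<le> ?H A"
      by (rule hausdorff_outer_measure_mono) (auto simp: R_def)
    finally show "(\<Sum>i<N. ?H (R (2 * i + k))) \<le> ?H A" .
  qed simp
  have sum_R: "(\<Sum>i. ?H (R i)) \<le> ?H A + ?H A"
  proof (rule suminf_le_const)
    fix N
    have "(\<Sum>i<N. ?H (R i)) \<le> (\<Sum>i<2 * N. ?H (R i))"
      by (rule sum_mono2) auto
    also have "\<dots> = (\<Sum>i<N. ?H (R (2 * i + 0))) + (\<Sum>i<N. ?H (R (2 * i + 1)))"
      by (induction N) (simp_all add: algebra_simps)
    also have "\<dots> \<le> (\<Sum>i. ?H (R (2 * i + 0))) + (\<Sum>i. ?H (R (2 * i + 1)))"
      by (intro add_mono sum_le_suminf) auto
    also have "\<dots> \<le> ?H A + ?H A"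
      by (intro add_mono sum_part)
    finally show "(\<Sum>i<N. ?H (R i)) \<le> ?H A + ?H A" .
  qed simp
  have fin_R: "(\<Sum>i. ?H (R i)) < top"
    using sum_R finA by (auto intro: le_less_trans)
  have bound: "?H (A \<inter> C) + ?H (A - C) \<le> ?H A + (\<Sum>i. ?H (R (i + n)))" for n
  proof -
    have "A - C \<subseteq> S n \<union> (\<Union>i. R (i + n))"
    proof
      fix x assume x: "x \<in> A - C"
      then have pos: "0 < ?d x"
        using C False infdist_pos_not_in_closed by blast
      show "x \<in> S n \<union> (\<Union>i. R (i + n))"
      proof (cases "r n \<le> ?d x")
        case True
        then show ?thesis using x by (simp add: S_def)
      next
        case False
        obtain m where m: "r m < ?d x" using r_small[OF pos] by auto
        define k where "k = (LEAST k. r k \<le> ?d x)"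
        have k: "r k \<le> ?d x"
          unfolding k_def by (rule LeastI[of _ m]) (use m in simp)
        have "n < k"
        proof (rule ccontr)
          assume "\<not> n < k"
          then have "r n \<le> r k" using r_less[of k n] by (cases "k = n") auto
          then show False using k False by simp
        qed
        then obtain j where j: "k = Suc j" "n \<le> j" by (cases k) auto
        have "\<not> r j \<le> ?d x"
          using not_less_Least[of j "\<lambda>k. r k \<le> ?d x"] j by (auto simp: k_def[symmetric])
        then have "x \<in> R (j - n + n)" using x k j by (simp add: R_def)
        then show ?thesis by blast
      qed
    qed
    then have "?H (A - C) \<le> ?H (S n \<union> (\<Union>i. R (i + n)))"
      by (rule hausdorff_outer_measure_mono)
    also have "\<dots> \<le> ?H (S n) + ?H (\<Union>i. R (i + n))"
      by (rule hausdorff_outer_measure_Un_le)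
    also have "\<dots> \<le> ?H (S n) + (\<Sum>i. ?H (R (i + n)))"
      by (intro add_left_mono hausdorff_outer_measure_UN_le)
    finally have "?H (A \<inter> C) + ?H (A - C)
        \<le> ?H (A \<inter> C) + (?H (S n) + (\<Sum>i. ?H (R (i + n))))"
      by (rule add_left_mono)
    also have "\<dots> = (?H (A \<inter> C) + ?H (S n)) + (\<Sum>i. ?H (R (i + n)))"
      by (simp add: add.assoc)
    also have "?H (A \<inter> C) + ?H (S n) \<le> ?H ((A \<inter> C) \<union> S n)"
    proof (rule hausdorff_outer_measure_separated[OF _ r_pos[of n]])
      fix x y assume "x \<in> A \<inter> C" "y \<in> S n"
      then show "r n \<le> dist x y"
        using infdist_le[of x C y] by (auto simp: S_def dist_commute)
    qed
    also have "\<dots> \<le> ?H A"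
      by (rule hausdorff_outer_measure_mono) (auto simp: S_def)
    finally show ?thesis by (simp add: add_right_mono)
  qed
  have tail: "(\<lambda>n. \<Sum>i. ?H (R (i + n))) \<longlonglongrightarrow> 0"
  proof -
    have fin: "?H (R i) < top" for i
      using fin_R by (auto simp add: less_top dest!: ennreal_suminf_lessD)
    have "summable (\<lambda>i. enn2real (?H (R i)))"
      using fin_R fin by (intro summable_suminf_not_top) auto
    then have "(\<lambda>n. \<Sum>i. enn2real (?H (R (i + n)))) \<longlonglongrightarrow> 0"
      by (rule suminf_exist_split2)
    then have "(\<lambda>n. ennreal (\<Sum>i. enn2real (?H (R (i + n))))) \<longlonglongrightarrow> ennreal 0"
      by (rule tendsto_ennrealI)
    moreover have "ennreal (\<Sum>i. enn2real (?H (R (i + n)))) = (\<Sum>i. ?H (R (i + n)))" for n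
    proof -
      have "summable (\<lambda>i. enn2real (?H (R (i + n))))"
        using \<open>summable (\<lambda>i. enn2real (?H (R i)))\<close> by (rule summable_ignore_initial_segment)
      then have "(\<Sum>i. ennreal (enn2real (?H (R (i + n)))))
          = ennreal (\<Sum>i. enn2real (?H (R (i + n))))"
        by (intro suminf_ennreal2) auto
      then show ?thesis using fin by simp
    qed
    ultimately show ?thesis by simp
  qed
  have "(\<lambda>n. ?H A + (\<Sum>i. ?H (R (i + n)))) \<longlonglongrightarrow> ?H A + 0"
    by (intro tendsto_add tail tendsto_const)
  then show ?thesis
    by (intro LIMSEQ_le_const[of _ "?H A"]) (use bound in auto)
qed

lemma measure_space_hausdorff:
  "measure_space UNIV (sets borel) (hausdorff_outer_measure s :: 'a::metric_space set \<Rightarrow> ennreal)"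
proof -
  let ?H = "hausdorff_outer_measure s :: 'a set \<Rightarrow> ennreal"
  let ?L = "lambda_system UNIV UNIV ?H"
  interpret P: sigma_algebra "UNIV :: 'a set" "UNIV :: 'a set set"
    using sigma_algebra_Pow[of "UNIV :: 'a set"] by simp
  have L: "measure_space UNIV ?L ?H"
    by (rule P.caratheodory_lemma[OF outer_measure_space_hausdorff])
  then interpret L: sigma_algebra UNIV ?L
    by (simp add: measure_space_def)
  have "C \<in> ?L" if "closed C" for C
    unfolding P.lambda_system_eq
  proof (intro CollectI conjI ballI UNIV_I antisym)
    fix A :: "'a set"
    show "?H (A \<inter> C) + ?H (A - C) \<le> ?H A"
      by (rule hausdorff_outer_measure_split_closed[OF that])
    show "?H A \<le> ?H (A \<inter> C) + ?H (A - C)"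
      using hausdorff_outer_measure_Un_le[of s "A \<inter> C" "A - C"] by (simp add: Int_Diff_Un)
  qed
  then have "sigma_sets UNIV (Collect closed) \<subseteq> ?L"
    by (intro L.sigma_sets_subset) auto
  then have borel: "sets borel \<subseteq> ?L"
    by (simp add: borel_eq_closed)
  show ?thesis
    using L borel sets.sigma_algebra_axioms[of "borel :: 'a measure"]
    unfolding measure_space_def positive_def countably_additive_def
    by (auto simp: subset_iff)
qed

lemma sets_hausdorff_measure [simp, measurable_cong]: "sets (hausdorff_measure s) = sets borel"
  unfolding hausdorff_measure_def by (metis sets.sigma_sets_eq sets_measure_of sets.space_closed space_borel)

lemma space_hausdorff_measure [simp]: "space (hausdorff_measure s) = UNIV"
  by (simp add: hausdorff_measure_def space_measure_of_conv)

lemma emeasure_hausdorff_measure: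
  assumes "A \<in> sets borel"
  shows "emeasure (hausdorff_measure s) A = hausdorff_outer_measure s A"
  using measure_space_hausdorff[of s] assms
  by (intro emeasure_measure_of[OF hausdorff_measure_def])
     (auto simp: measure_space_def sets_hausdorff_measure)


section \<open>Homogeneous iterated function systems in the plane\<close>

definition rotation_by :: "real \<Rightarrow> real^2^2" where
  "rotation_by \<alpha> = vector [vector [cos \<alpha>, - sin \<alpha>], vector [sin \<alpha>, cos \<alpha>]]"

definition homogeneous_ifs ::
    "real \<Rightarrow> real \<Rightarrow> 'i set \<Rightarrow> ('i \<Rightarrow> real^2 \<Rightarrow> real^2) \<Rightarrow> bool" where
  "homogeneous_ifs \<rho> \<alpha> \<Lambda> h \<longleftrightarrow>
     finite \<Lambda> \<and> \<Lambda> \<noteq> {} \<and> 0 < \<rho> \<and> \<rho> < 1 \<and>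
     (\<exists>b. \<forall>i\<in>\<Lambda>. \<forall>x. h i x = \<rho> *\<^sub>R (rotation_by \<alpha> *v x) + b i)"

definition irrational_angle :: "real \<Rightarrow> bool" where
  "irrational_angle \<alpha> \<longleftrightarrow> \<alpha> \<notin> (\<lambda>q. q * pi) ` \<rat>"

definition open_set_condition :: "'i set \<Rightarrow> ('i \<Rightarrow> 'a \<Rightarrow> 'a::topological_space) \<Rightarrow> bool" where
  "open_set_condition \<Lambda> h \<longleftrightarrow>
     (\<exists>U. open U \<and> U \<noteq> {} \<and> (\<forall>i\<in>\<Lambda>. h i ` U \<subseteq> U) \<and>
          (\<forall>i\<in>\<Lambda>. \<forall>j\<in>\<Lambda>. i \<noteq> j \<longrightarrow> h i ` U \<inter> h j ` U = {}))"

definition is_limit_set ::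
    "'i set \<Rightarrow> ('i \<Rightarrow> 'a \<Rightarrow> 'a::topological_space) \<Rightarrow> 'a set \<Rightarrow> bool" where
  "is_limit_set \<Lambda> h K \<longleftrightarrow> compact K \<and> K \<noteq> {} \<and> K = (\<Union>i\<in>\<Lambda>. h i ` K)"


section \<open>Frostman exponents and projections\<close>

text \<open>
  The library's \<open>ln\<close> is not usable at a supremum of measures equal to \<open>0\<close> or \<open>\<infinity>\<close>; here
  \<open>log 0 = -\<infinity>\<close> and \<open>log \<infinity> = \<infinity>\<close>. Exponents are extended reals.
\<close>

definition log_ennreal :: "ennreal \<Rightarrow> ereal" where
  "log_ennreal x =
     (if x = 0 then - \<infinity> else if x = top then \<infinity> else ereal (ln (enn2real x)))"

definition frostman_exponent :: "'a::euclidean_space measure \<Rightarrow> ereal" where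
  "frostman_exponent \<nu> =
     Liminf (at_right 0) (\<lambda>\<epsilon>. log_ennreal (SUP x. emeasure \<nu> (ball x \<epsilon>)) / ereal (ln \<epsilon>))"

definition affine_lines :: "(real^2) set set" where
  "affine_lines = {L. affine L \<and> aff_dim L = 1}"

definition open_neighborhood :: "real \<Rightarrow> 'a::metric_space set \<Rightarrow> 'a set" where
  "open_neighborhood \<epsilon> L = (\<Union>y\<in>L. ball y \<epsilon>)"

definition line_exponent :: "(real^2) measure \<Rightarrow> ereal" where
  "line_exponent \<mu> =
     Liminf (at_right 0)
       (\<lambda>\<epsilon>. log_ennreal (SUP L\<in>affine_lines. emeasure \<mu> (open_neighborhood \<epsilon> L)) / ereal (ln \<epsilon>))"

text \<open>
  Orthogonal projection onto the line spanned by the unit vector \<open>(cos \<theta>, sin \<theta>)\<close>, in the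
  isometric coordinate of that line. Each line through the origin is given by exactly one
  \<open>\<theta> \<in> [0, \<pi>)\<close>, so \<open>Gr(2,1)\<close> is parametrised by that interval.
\<close>

definition proj_line :: "real \<Rightarrow> real^2 \<Rightarrow> real" where
  "proj_line \<theta> x = x \<bullet> vector [cos \<theta>, sin \<theta>]"

end

theory Submission
  imports Defs
begin

text \<open>
  Let \<open>Z n \<theta>\<close> (below \<open>max_cluster n \<theta>\<close>) be the largest number of words of length \<open>n\<close> whose pieces have projections in
  direction \<open>\<theta>\<close> within \<open>D * \<rho>\<^sup>n\<close> of each other. Up to constants, \<open>\<rho>\<^sup>n\<^sup>s * Z n \<theta>\<close> is the largest
  measure of a strip of width \<open>\<rho>\<^sup>n\<close> orthogonal to \<open>\<theta>\<close>: the pieces of a cluster overlap boundedly by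
  the open set condition. Since all the maps rotate by \<open>\<alpha>\<close>, \<open>ln (Z n \<theta>)\<close> is a subadditive cocycle over
  the rotation by \<open>-\<alpha>\<close> on directions. As this rotation is irrational, orbit averages are governed
  uniformly by the mean, so the exponential growth rate \<open>\<gamma>\<close> of \<open>sup\<^sub>\<theta> (Z n \<theta>)\<close> is at most \<open>1/n\<close> times
  the mean of \<open>ln (Z n \<theta>)\<close> plus \<open>O(1/n)\<close>. A function that is asymptotically at most \<open>\<gamma>\<close> with mean
  asymptotically at least \<open>\<gamma>\<close> is close to \<open>\<gamma>\<close> in measure, hence \<open>ln (Z n \<theta>) / n\<close> has upper limit
  \<open>\<gamma>\<close> for almost every \<open>\<theta>\<close>.
\<close>

section \<open>Subadditive cocycles over irrational rotations\<close>

text \<open>Kronecker's theorem is applied only at the grid points \<open>i / M\<close> with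
  \<open>1 / M < e / 2\<close>. As the grid is finite, the largest index used there bounds
  \<open>j\<close> for every \<open>t\<close> at once.\<close>

lemma irrational_multiples_uniformly_dense:
  fixes a e :: real
  assumes "a \<notin> \<rat>" "e > 0"
  obtains J where "\<And>t. \<exists>j\<le>J. \<exists>l::int. \<bar>t - real j * a - of_int l\<bar> < e"
proof -
  obtain M :: nat where M: "M > 0" "1 / M < e / 2"
    using assms(2) by (metis half_gt_zero gr_zeroI inverse_eq_divide real_arch_inverse)
  have "\<exists>k::nat. \<bar>frac (real k * a) - real i / M\<bar> < e / 2" if "i \<le> M" for i
    using Kronecker_approx_1_explicit[OF assms(1), of "real i / M" "e / 2"] that M assms(2)
    by (auto simp: field_simps)
  then obtain k :: "nat \<Rightarrow> nat" where
    k: "\<And>i. i \<le> M \<Longrightarrow> \<bar>frac (real (k i) * a) - real i / M\<bar> < e / 2"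
    by metis
  show thesis
  proof
    fix t :: real
    define i where "i = nat \<lfloor>frac t * M\<rfloor>"
    have i_le: "real i \<le> frac t * M" and i_gt: "frac t * M < real i + 1"
      using frac_ge_0[of t] M by (auto simp: i_def)
    have "frac t * M \<le> real M"
      using frac_lt_1[of t] by (intro mult_left_le_one_le) auto
    with i_le have "real i \<le> real M" by linarith
    then have iM: "i \<le> M" by simp
    have "frac t - real i / M = (frac t * M - real i) / M"
      using M by (simp add: field_simps)
    moreover have "\<bar>(frac t * M - real i) / M\<bar> \<le> 1 / M"
      using i_le i_gt M by (simp add: divide_right_mono)
    ultimately have "\<bar>frac t - real i / M\<bar> \<le> 1 / M"
      by simp
    then have "\<bar>frac t - frac (real (k i) * a)\<bar> < e"
      using k[OF iM] M by linarith
    then have "\<bar>t - real (k i) * a - of_int (\<lfloor>t\<rfloor> - \<lfloor>real (k i) * a\<rfloor>)\<bar> < e"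
      by (simp add: frac_def algebra_simps)
    moreover have "k i \<le> Max (k ` {..M})"
      using iM by simp
    ultimately show "\<exists>j\<le>Max (k ` {..M}). \<exists>l::int. \<bar>t - real j * a - of_int l\<bar> < e"
      by blast
  qed
qed

section \<open>Periodic functions and integrals over one period\<close>

lemma periodic_of_int:
  fixes f :: "real \<Rightarrow> 'a"
  assumes "\<And>x. f (x + p) = f x"
  shows "f (x + of_int l * p) = f x"
proof -
  have nat: "f (x + real n * p) = f x" for x n
  proof (induction n)
    case (Suc n)
    have "x + real (Suc n) * p = (x + real n * p) + p" by (simp add: algebra_simps)
    with Suc show ?case by (simp only: assms)
  qed simp
  show ?thesis
  proof (cases "0 \<le> l")
    case True
    then show ?thesis using nat[of x "nat l"] by simp
  next
    case False
    then show ?thesis using nat[of "x + of_int l * p" "nat (- l)"] by simp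
  qed
qed

lemma set_integrable_bounded:
  fixes f :: "real \<Rightarrow> real"
  assumes "f \<in> borel_measurable borel" "\<And>x. \<bar>f x\<bar> \<le> B" "S \<in> sets borel" "emeasure lborel S < \<infinity>"
  shows "set_integrable lborel S f"
  unfolding set_integrable_def
  by (rule integrableI_bounded_set[where A = S and B = B])
    (use assms in \<open>auto split: split_indicator\<close>)

text \<open>The shift is reduced modulo \<open>p\<close> to some \<open>u\<close> in
  \<open>[0, p)\<close>. The window then becomes \<open>{-u..<p - u}\<close>, and moving its part
  left of 0 by one period restores \<open>{0..<p}\<close>.\<close>

lemma set_integral_periodic_shift:
  fixes f :: "real \<Rightarrow> real"
  assumes meas: "f \<in> borel_measurable borel" and bnd: "\<And>x. \<bar>f x\<bar> \<le> B"
    and per: "\<And>x. f (x + p) = f x" and p: "0 < p"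
  shows "(LINT x:{0..<p}|lborel. f (x - t)) = (LINT x:{0..<p}|lborel. f x)"
proof -
  define l where "l = \<lfloor>t / p\<rfloor>"
  define u where "u = t - of_int l * p"
  have u: "0 \<le> u" "u < p"
    using p floor_divide_lower[OF p, of t] floor_divide_upper[OF p, of t]
    by (auto simp: u_def l_def algebra_simps)
  have int: "set_integrable lborel {a..<b} f" for a b
    using set_integrable_bounded[OF meas bnd] by (cases "a \<le> b") auto
  have shift: "(LINT x:{a + c..<b + c}|lborel. f (x - c)) = (LINT x:{a..<b}|lborel. f x)" for a b c
  proof -
    have "(LINT x:{a + c..<b + c}|lborel. f (x - c))
        = (LINT x|lborel. indicator {a + c..<b + c} (c + 1 * x) *\<^sub>R f (c + 1 * x - c))"
      unfolding set_lebesgue_integral_def by (subst lborel_integral_real_affine[of 1 _ c]) auto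
    also have "\<dots> = (LINT x:{a..<b}|lborel. f x)"
      unfolding set_lebesgue_integral_def
      by (intro Bochner_Integration.integral_cong) (auto split: split_indicator)
    finally show ?thesis .
  qed
  have fu: "f (x - t) = f (x - u)" for x
    using periodic_of_int[of f p "x - t" l, OF per] by (simp add: u_def algebra_simps)
  have "(LINT x:{0..<p}|lborel. f (x - t)) = (LINT x:{-u..<p - u}|lborel. f x)"
    using shift[of "-u" u "p - u"] by (simp add: fu)
  also have "{-u..<p - u} = {-u..<0} \<union> {0..<p - u}" using u by auto
  also have "(LINT x:{-u..<0} \<union> {0..<p - u}|lborel. f x)
      = (LINT x:{-u..<0}|lborel. f x) + (LINT x:{0..<p - u}|lborel. f x)"
    by (rule set_integral_Un) (auto intro: int)
  also have "(LINT x:{-u..<0}|lborel. f x) = (LINT x:{p - u..<p}|lborel. f x)"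
  proof -
    have "f (x - p) = f x" for x using per[of "x - p"] by simp
    then show ?thesis using shift[of "-u" p 0] by simp
  qed
  also have "(LINT x:{p - u..<p}|lborel. f x) + (LINT x:{0..<p - u}|lborel. f x)
      = (LINT x:{0..<p - u} \<union> {p - u..<p}|lborel. f x)"
    by (subst set_integral_Un) (auto intro: int)
  also have "{0..<p - u} \<union> {p - u..<p} = {0..<p}" using u by auto
  finally show ?thesis .
qed

text \<open>Two orbits of the rotation shadow each other after a bounded delay, so any two orbit sums
  differ by at most \<open>c * k\<close> plus a constant; averaging over the second orbit gives the mean.\<close>

lemma irrational_rotation_orbit_sum_le:
  fixes f :: "real \<Rightarrow> real"
  assumes meas: "f \<in> borel_measurable borel" and bnd: "\<And>x. 0 \<le> f x" "\<And>x. f x \<le> B"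
    and per: "\<And>x. f (x + p) = f x" and p: "0 < p"
    and irr: "\<beta> / p \<notin> \<rat>"
    and \<delta>: "0 < \<delta>" "\<And>x y. \<bar>x - y\<bar> < \<delta> \<Longrightarrow> f x \<le> f y + c"
  obtains C where "\<And>k x. (\<Sum>i<k. f (x - real i * \<beta>))
    \<le> real k * ((LINT x:{0..<p}|lborel. f x) / p + c) + C"
proof -
  obtain J where J: "\<And>t. \<exists>j\<le>J. \<exists>l::int. \<bar>t - real j * (\<beta> / p) - of_int l\<bar> < \<delta> / p"
    using irrational_multiples_uniformly_dense[OF irr] \<delta> p by (metis divide_pos_pos)
  have B: "0 \<le> B" using bnd[of 0] by linarith
  have fB: "\<bar>f x\<bar> \<le> B" for x using bnd[of x] by simp
  define S where "S k y = (\<Sum>i<k. f (y - real i * \<beta>))" for k y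
  have step: "S k x \<le> S k y + (real J * B + c * real k)" for k x y
  proof -
    \<comment> \<open>Modulo \<open>p\<close>, the point \<open>x\<close> lies within
      \<open>\<delta>\<close> of \<open>y - j * \<beta>\<close>, so the orbit of \<open>x\<close>
      follows that of \<open>y\<close> with a delay of \<open>j \<le> J\<close> steps.\<close>
    obtain j and l :: int where j: "j \<le> J"
      and l: "\<bar>(y - x) / p - real j * (\<beta> / p) - of_int l\<bar> < \<delta> / p"
      using J by blast
    have "(y - x) / p - real j * (\<beta> / p) - of_int l = - (x - (y - real j * \<beta> - of_int l * p)) / p"
      using p by (simp add: field_simps)
    then have "\<bar>(y - x) / p - real j * (\<beta> / p) - of_int l\<bar> = \<bar>x - (y - real j * \<beta> - of_int l * p)\<bar> / p"
      using p by (simp only: abs_divide abs_minus_cancel abs_of_pos)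
    then have close: "\<bar>x - (y - real j * \<beta> - of_int l * p)\<bar> < \<delta>"
      using l p by (simp add: divide_less_cancel)
    have "f (x - real i * \<beta>) \<le> f (y - real (i + j) * \<beta>) + c" for i
    proof -
      have "f (x - real i * \<beta>) \<le> f (y - real j * \<beta> - of_int l * p - real i * \<beta>) + c"
        by (rule \<delta>(2)) (use close in simp)
      also have "f (y - real j * \<beta> - of_int l * p - real i * \<beta>) = f (y - real (i + j) * \<beta>)"
        using periodic_of_int[of f p "y - real (i + j) * \<beta>" "- l", OF per]
        by (simp add: algebra_simps)
      finally show ?thesis .
    qed
    then have "S k x \<le> (\<Sum>i<k. f (y - real (i + j) * \<beta>) + c)"
      unfolding S_def by (intro sum_mono)
    also have "\<dots> = (\<Sum>i\<in>{j..<k + j}. f (y - real i * \<beta>)) + c * real k"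
      unfolding sum.distrib
      using sum.shift_bounds_nat_ivl[of "\<lambda>i. f (y - real i * \<beta>)" 0 j k]
      by (simp add: atLeast0LessThan)
    \<comment> \<open>Nonnegativity of \<open>f\<close> allows adding the skipped terms of small
      index; the \<open>j\<close> terms from index \<open>k\<close> on cost at most \<open>B\<close>
      each.\<close>
    also have "(\<Sum>i\<in>{j..<k + j}. f (y - real i * \<beta>)) \<le> (\<Sum>i\<in>{..<k} \<union> {k..<k + j}. f (y - real i * \<beta>))"
      by (rule sum_mono2) (auto simp: bnd)
    also have "\<dots> = S k y + (\<Sum>i\<in>{k..<k + j}. f (y - real i * \<beta>))"
      unfolding S_def by (rule sum.union_disjoint) auto
    also have "(\<Sum>i\<in>{k..<k + j}. f (y - real i * \<beta>)) \<le> real j * B"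
      using sum_bounded_above[of "{k..<k + j}" "\<lambda>i. f (y - real i * \<beta>)" B] bnd by simp
    also have "real j * B \<le> real J * B"
      using j B by (intro mult_right_mono) auto
    finally show ?thesis by simp
  qed
  have int1: "set_integrable lborel {0..<p} (\<lambda>y. f (y - t))" for t
    using p by (intro set_integrable_bounded[of _ B] fB measurable_compose[OF _ meas]) auto
  have "S k x \<le> real k * ((LINT x:{0..<p}|lborel. f x) / p + c) + real J * B" for k x
  proof -
    let ?I = "LINT x:{0..<p}|lborel. f x"
    have intS: "set_integrable lborel {0..<p} (S k)"
      using int1 unfolding S_def set_integrable_def scaleR_sum_right
      by (intro Bochner_Integration.integrable_sum)
    have intc: "set_integrable lborel {0..<p} (\<lambda>y. d)" for d :: real
      using p by (intro set_integrable_bounded[of _ "\<bar>d\<bar>"]) auto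
    have const: "(LINT y:{0..<p}|lborel. d) = p * d" for d :: real
      using p by (simp add: set_integral_const)
    have "p * S k x = (LINT y:{0..<p}|lborel. S k x)"
      by (simp only: const)
    also have "\<dots> \<le> (LINT y:{0..<p}|lborel. S k y + (real J * B + c * real k))"
      by (intro set_integral_mono set_integral_add intc intS step)
    also have "\<dots> = (LINT y:{0..<p}|lborel. S k y) + p * (real J * B + c * real k)"
      by (subst set_integral_add) (auto simp only: intc intS const)
    also have "(LINT y:{0..<p}|lborel. S k y) = (\<Sum>i<k. LINT y:{0..<p}|lborel. f (y - real i * \<beta>))"
      using int1 unfolding S_def set_integrable_def set_lebesgue_integral_def scaleR_sum_right
      by (intro Bochner_Integration.integral_sum) auto
    also have "\<dots> = real k * ?I"
      by (simp add: set_integral_periodic_shift[OF meas fB per p])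
    finally show ?thesis using p by (simp add: field_simps)
  qed
  then show thesis using that unfolding S_def by blast
qed

section \<open>Growth rate of a subadditive cocycle\<close>

text \<open>A semi-uniform subadditive ergodic theorem, with \<open>\<gamma>\<close> the infimum of
  the uniform growth rates. Cutting time into blocks shows that the mean of \<open>f n\<close> is at
  least \<open>\<gamma> * n - c\<close>, so \<open>f n\<close> cannot stay below
  \<open>(\<gamma> - \<delta>) * n\<close> on a set of positive measure for all large
  \<open>n\<close>. Here \<open>cont\<close> is continuity up to a defect \<open>c\<close> that does
  not depend on \<open>n\<close> and is negligible after division by \<open>n\<close>.\<close>

lemma subadditive_cocycle_irrational_rotation:
  fixes f :: "nat \<Rightarrow> real \<Rightarrow> real"
  assumes meas: "\<And>n. f n \<in> borel_measurable borel"
    and nonneg: "\<And>n x. 0 \<le> f n x" and le: "\<And>n x. f n x \<le> B * real n"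
    and per: "\<And>n x. f n (x + p) = f n x" and p: "0 < p"
    and irr: "\<beta> / p \<notin> \<rat>"
    and sub: "\<And>m n x. f (m + n) x \<le> f m x + f n (x - real m * \<beta>)"
    and c: "0 \<le> c"
    and cont: "\<And>n. \<exists>\<delta>>0. \<forall>x y. \<bar>x - y\<bar> < \<delta> \<longrightarrow> f n x \<le> f n y + c"
  obtains \<gamma> where "\<And>\<delta>. 0 < \<delta> \<Longrightarrow> \<exists>n0. \<forall>n\<ge>n0. \<forall>x. f n x \<le> (\<gamma> + \<delta>) * real n"
    and "AE x in lborel. x \<in> {0..<p} \<longrightarrow>
      (\<forall>\<delta>>0. \<exists>\<^sub>F n in sequentially. (\<gamma> - \<delta>) * real n \<le> f n x)"
proof -
  define G where "G = {g. \<exists>n0. \<forall>n\<ge>n0. \<forall>x. f n x \<le> g * real n}"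
  define \<gamma> where "\<gamma> = Inf G"
  define I where "I n = (LINT x:{0..<p}|lborel. f n x)" for n
  have B: "0 \<le> B" using nonneg[of 1 0] le[of 1 0] by simp
  have BG: "B \<in> G" unfolding G_def using le by blast
  have G0: "0 \<le> g" if g: "g \<in> G" for g
  proof -
    obtain n0 where n0: "\<And>n x. n \<ge> n0 \<Longrightarrow> f n x \<le> g * real n"
      using g unfolding G_def by blast
    have "0 \<le> g * real (max n0 1)"
      using n0[of "max n0 1" 0] nonneg[of "max n0 1" 0] by linarith
    then show ?thesis by (simp add: zero_le_mult_iff)
  qed
  have bdd: "bdd_below G" using G0 by (rule bdd_belowI)
  have upper: "\<exists>n0. \<forall>n\<ge>n0. \<forall>x. f n x \<le> (\<gamma> + \<delta>) * real n" if "0 < \<delta>" for \<delta>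
  proof -
    have "\<exists>g\<in>G. g < \<gamma> + \<delta>"
      using BG that cInf_lessD[of G "\<gamma> + \<delta>"] by (auto simp: \<gamma>_def)
    then obtain g n0 where g: "g < \<gamma> + \<delta>" "\<And>n x. n \<ge> n0 \<Longrightarrow> f n x \<le> g * real n"
      unfolding G_def by blast
    have "f n x \<le> (\<gamma> + \<delta>) * real n" if "n \<ge> n0" for n x
      using g(2)[OF that, of x] mult_right_mono[of g "\<gamma> + \<delta>" "real n"] g(1) by simp
    then show ?thesis by blast
  qed
  have fabs: "\<bar>f n x\<bar> \<le> B * real n" for n x using nonneg[of n x] le[of n x] by simp
  have intf: "set_integrable lborel {0..<p} (f n)" for n
    using p by (intro set_integrable_bounded[OF meas fabs]) auto
  have I0: "0 \<le> I n" for n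
    unfolding I_def set_lebesgue_integral_def by (intro Bochner_Integration.integral_nonneg) (simp add: nonneg)
  \<comment> \<open>The orbit sum bound is used for \<open>f n\<close> over the rotation by
    \<open>n * \<beta>\<close>. Cutting a time \<open>l\<close> into blocks of length
    \<open>n\<close> shows that \<open>(I n / p + c) / n + \<eta>\<close> belongs to
    \<open>G\<close> for every \<open>\<eta> > 0\<close>.\<close>
  have mean: "\<gamma> * real n \<le> I n / p + c" if n: "n > 0" for n
  proof -
    obtain \<delta> where \<delta>: "\<delta> > 0" "\<And>x y. \<bar>x - y\<bar> < \<delta> \<Longrightarrow> f n x \<le> f n y + c"
      using cont by blast
    have irrn: "real n * \<beta> / p \<notin> \<rat>"
    proof
      assume "real n * \<beta> / p \<in> \<rat>"
      then have "real n * \<beta> / p / real n \<in> \<rat>" by (rule Rats_divide) simp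
      then show False using irr n by simp
    qed
    obtain C where C: "\<And>k x. (\<Sum>i<k. f n (x - real i * (real n * \<beta>)))
        \<le> real k * ((LINT x:{0..<p}|lborel. f n x) / p + c) + C"
      using irrational_rotation_orbit_sum_le[OF meas nonneg le per p irrn \<delta>] by blast
    \<comment> \<open>\<open>r\<close> is kept arbitrary: the induction hypothesis is used with
      remainder \<open>n + r\<close>, from which one further block is then split off.\<close>
    have split: "f (k * n + r) x \<le> (\<Sum>i<k. f n (x - real i * (real n * \<beta>)))
        + f r (x - real k * (real n * \<beta>))" for k r x
    proof (induction k arbitrary: r)
      case (Suc k)
      have "f (Suc k * n + r) x = f (k * n + (n + r)) x" by (simp add: algebra_simps)
      also have "\<dots> \<le> (\<Sum>i<k. f n (x - real i * (real n * \<beta>)))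
          + f (n + r) (x - real k * (real n * \<beta>))" by (rule Suc)
      also have "f (n + r) (x - real k * (real n * \<beta>)) \<le> f n (x - real k * (real n * \<beta>))
          + f r (x - real k * (real n * \<beta>) - real n * \<beta>)" by (rule sub)
      also have "x - real k * (real n * \<beta>) - real n * \<beta> = x - real (Suc k) * (real n * \<beta>)"
        by (simp add: algebra_simps)
      finally show ?case by simp
    qed simp
    have "\<gamma> \<le> (I n / p + c) / n + \<eta>" if \<eta>: "\<eta> > 0" for \<eta>
    proof -
      obtain n0 :: nat where n0: "(C + B * real n) / \<eta> \<le> real n0"
        using real_arch_simple by blast
      have "f l x \<le> ((I n / p + c) / n + \<eta>) * real l" if l: "l \<ge> n0" for l x
      proof -
        define k r where "k = l div n" and "r = l mod n"
        have lkr: "l = k * n + r" and r: "r < n" using n by (auto simp: k_def r_def)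
        have "f l x \<le> (real k * (I n / p + c) + C) + B * real r"
          unfolding lkr I_def
          by (intro order_trans[OF split] add_mono C le)
        also have "B * real r \<le> B * real n" using r B by (intro mult_left_mono) auto
        \<comment> \<open>\<open>k \<le> l / n\<close>, and the common factor is nonnegative because
          \<open>I n\<close> and \<open>c\<close> are.\<close>
        also have "real k * (I n / p + c) \<le> (real l / n) * (I n / p + c)"
          using n p c I0[of n] by (intro mult_right_mono) (auto simp: lkr field_simps)
        finally have "f l x \<le> (real l / n) * (I n / p + c) + (C + B * real n)"
          by simp
        also have "C + B * real n \<le> \<eta> * real l"
        proof -
          have "(C + B * real n) / \<eta> \<le> real l" using n0 l by linarith
          then show ?thesis using \<eta> by (simp add: field_simps)
        qed
        also have "(real l / n) * (I n / p + c) + \<eta> * real l = ((I n / p + c) / n + \<eta>) * real l"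
          by (metis (no_types) distrib_right mult.commute times_divide_eq_right)
        finally show ?thesis by simp
      qed
      then have "(I n / p + c) / n + \<eta> \<in> G" unfolding G_def by blast
      then show ?thesis unfolding \<gamma>_def using bdd by (rule cInf_lower)
    qed
    then have "\<gamma> \<le> (I n / p + c) / n" by (rule field_le_epsilon)
    then show ?thesis using n by (simp add: field_simps)
  qed
  \<comment> \<open>The exceptional sets: a point of the period outside all
    \<open>E \<delta> m\<close> exceeds \<open>(\<gamma> - \<delta>) * n\<close> for infinitely many
    \<open>n\<close>, whatever \<open>\<delta> > 0\<close>. Hence it suffices that each of them is
    null.\<close>
  define E where "E \<delta> m = {x \<in> {0..<p}. \<forall>n\<ge>m. f n x \<le> (\<gamma> - \<delta>) * real n}" for \<delta> m
  have E_meas: "E \<delta> m \<in> sets borel" for \<delta> m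
  proof -
    note meas[measurable]
    have "{x \<in> space borel. x \<in> {0..<p} \<and> (\<forall>n\<in>{m..}. f n x \<le> (\<gamma> - \<delta>) * real n)} \<in> sets borel"
      by measurable
    then show ?thesis by (simp add: E_def Ball_def)
  qed
  have E_sub: "E \<delta> m \<subseteq> {0..<p}" for \<delta> m by (auto simp: E_def)
  have E_fin: "emeasure lborel (E \<delta> m) < \<infinity>" for \<delta> m
  proof -
    have "emeasure lborel (E \<delta> m) \<le> emeasure lborel {0..<p}"
      by (rule emeasure_mono[OF E_sub]) simp
    also have "\<dots> < \<infinity>" using p by simp
    finally show ?thesis .
  qed
  have null: "emeasure lborel (E \<delta> m) = 0" if \<delta>: "\<delta> > 0" for \<delta> m
  proof -
    let ?e = "measure lborel (E \<delta> m)"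
    have "?e * \<delta> \<le> 0 + \<eta>'" if \<eta>': "\<eta>' > 0" for \<eta>'
    proof -
      \<comment> \<open>This makes \<open>2 * p * \<eta>\<close> equal to \<open>\<eta>'\<close>;
        the former is the bound obtained below for \<open>\<delta>\<close> times the measure of
        \<open>E \<delta> m\<close>.\<close>
      define \<eta> where "\<eta> = \<eta>' / (2 * p)"
      have \<eta>: "\<eta> > 0" using \<eta>' p by (simp add: \<eta>_def)
      obtain n0 where n0: "\<And>n x. n \<ge> n0 \<Longrightarrow> f n x \<le> (\<gamma> + \<eta>) * real n"
        using upper[OF \<eta>] by blast
      obtain n1 :: nat where n1: "c / \<eta> \<le> real n1" using real_arch_simple by blast
      \<comment> \<open>Large enough for the uniform upper bound, for the bound defining
        \<open>E \<delta> m\<close>, and for the defect \<open>c\<close> to be at most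
        \<open>\<eta> * n\<close>.\<close>
      define n where "n = max (max n0 n1) (max m 1)"
      have n: "n \<ge> n0" "n \<ge> m" "n > 0" "c \<le> \<eta> * real n"
      proof -
        have "c / \<eta> \<le> real n" using n1 by (auto simp: n_def)
        then show "c \<le> \<eta> * real n" using \<eta> by (simp add: field_simps)
      qed (auto simp: n_def)
      have int1: "set_integrable lborel {0..<p} (\<lambda>x. (\<gamma> + \<eta>) * real n)"
        using p by (intro set_integrable_bounded[of _ "\<bar>(\<gamma> + \<eta>) * real n\<bar>"]) auto
      have int2: "set_integrable lborel {0..<p} (\<lambda>x. (\<delta> + \<eta>) * real n * indicator (E \<delta> m) x)"
        using p E_meas[of \<delta> m] \<delta> \<eta> by (intro set_integrable_bounded[of _ "(\<delta> + \<eta>) * real n"])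
          (auto split: split_indicator)
      \<comment> \<open>\<open>f n\<close> is at most \<open>(\<gamma> + \<eta>) * n\<close>
        everywhere and smaller by \<open>(\<delta> + \<eta>) * n\<close> on
        \<open>E \<delta> m\<close>. Against the lower bound \<open>mean\<close> for the integral,
        this leaves little room for \<open>E \<delta> m\<close>.\<close>
      have "I n \<le> (LINT x:{0..<p}|lborel. (\<gamma> + \<eta>) * real n - (\<delta> + \<eta>) * real n * indicator (E \<delta> m) x)"
        unfolding I_def
      proof (intro set_integral_mono intf set_integral_diff int1 int2)
        fix x
        show "f n x \<le> (\<gamma> + \<eta>) * real n - (\<delta> + \<eta>) * real n * indicator (E \<delta> m) x"
          using n n0[of n x] by (auto simp: E_def algebra_simps split: split_indicator)
      qed
      also have "\<dots> = p * ((\<gamma> + \<eta>) * real n) - (\<delta> + \<eta>) * real n * ?e"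
      proof (subst set_integral_diff(2)[OF int1 int2], intro arg_cong2[of _ _ _ _ minus])
        show "(LINT x:{0..<p}|lborel. (\<gamma> + \<eta>) * real n) = p * ((\<gamma> + \<eta>) * real n)"
          using p by (simp add: set_integral_const)
        have "(LINT x:{0..<p}|lborel. (\<delta> + \<eta>) * real n * indicator (E \<delta> m) x)
            = (LINT x|lborel. (\<delta> + \<eta>) * real n * indicator (E \<delta> m) x)"
          unfolding set_lebesgue_integral_def using E_sub[of \<delta> m]
          by (intro Bochner_Integration.integral_cong) (auto split: split_indicator)
        also have "\<dots> = (\<delta> + \<eta>) * real n * ?e"
          using E_meas[of \<delta> m] E_fin[of \<delta> m] by simp
        finally show "(LINT x:{0..<p}|lborel. (\<delta> + \<eta>) * real n * indicator (E \<delta> m) x)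
            = (\<delta> + \<eta>) * real n * ?e" .
      qed
      finally have 1: "I n \<le> p * ((\<gamma> + \<eta>) * real n) - (\<delta> + \<eta>) * real n * ?e" .
      have 2: "p * (\<gamma> * real n) \<le> I n + p * (\<eta> * real n)"
      proof -
        have "\<gamma> * real n \<le> I n / p + \<eta> * real n" using mean[OF n(3)] n(4) by linarith
        then show ?thesis using p by (simp add: field_simps)
      qed
      from 1 2 have "(\<delta> * ?e + \<eta> * ?e) * real n \<le> (2 * p * \<eta>) * real n"
        by (simp add: algebra_simps)
      then have "\<delta> * ?e + \<eta> * ?e \<le> 2 * p * \<eta>" using n(3) by simp
      moreover have "0 \<le> \<eta> * ?e" using \<eta> by simp
      ultimately show ?thesis using p by (simp add: \<eta>_def mult.commute)
    qed
    then have "?e * \<delta> \<le> 0" by (rule field_le_epsilon)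
    then have "?e = 0" using \<delta> measure_nonneg[of lborel "E \<delta> m"] by (simp add: mult_le_0_iff)
    moreover have "emeasure lborel (E \<delta> m) = ennreal ?e"
      using E_fin[of \<delta> m] by (intro emeasure_eq_ennreal_measure) auto
    ultimately show ?thesis by simp
  qed
  \<comment> \<open>The rates \<open>1 / Suc i\<close> suffice, which leaves a countable union of
    null sets.\<close>
  have "AE x in lborel. \<forall>i m. x \<notin> E (1 / real (Suc i)) m"
    unfolding AE_all_countable
  proof (intro allI)
    fix i m
    show "AE x in lborel. x \<notin> E (1 / real (Suc i)) m"
      by (rule AE_not_in) (use null[of "1 / real (Suc i)" m] E_meas in \<open>auto intro: null_setsI\<close>)
  qed
  then have lower: "AE x in lborel. x \<in> {0..<p} \<longrightarrow>
      (\<forall>\<delta>>0. \<exists>\<^sub>F n in sequentially. (\<gamma> - \<delta>) * real n \<le> f n x)"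
  proof eventually_elim
    case (elim x)
    show ?case
    proof (intro impI allI)
      fix \<delta> :: real assume x: "x \<in> {0..<p}" and \<delta>: "0 < \<delta>"
      obtain i where i: "1 / real (Suc i) < \<delta>"
        using reals_Archimedean[OF \<delta>] by (auto simp: inverse_eq_divide)
      have "\<exists>n\<ge>m. (\<gamma> - \<delta>) * real n \<le> f n x" for m
      proof -
        obtain n where n: "n \<ge> m" "\<not> f n x \<le> (\<gamma> - 1 / real (Suc i)) * real n"
          using elim x unfolding E_def by blast
        have "(\<gamma> - \<delta>) * real n \<le> (\<gamma> - 1 / real (Suc i)) * real n"
          using i by (intro mult_right_mono) auto
        then show ?thesis using n by (intro exI[of _ n]) linarith
      qed
      then show "\<exists>\<^sub>F n in sequentially. (\<gamma> - \<delta>) * real n \<le> f n x"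
        by (simp add: frequently_sequentially)
    qed
  qed
  show thesis using upper lower by (rule that)
qed

section \<open>Similarities, Hausdorff measure and projections\<close>

lemma diameter_similarity_image_le:
  fixes f :: "'a::metric_space \<Rightarrow> 'b::metric_space"
  assumes f: "\<And>x y. dist (f x) (f y) = c * dist x y" and c: "0 < c" and U: "bounded U"
  shows "diameter (f ` U) \<le> c * diameter U"
proof (cases "U = {}")
  case False
  have "dist (f x) (f y) \<le> c * diameter U" if "x \<in> U" "y \<in> U" for x y
    using diameter_bounded_bound[OF U that] c by (simp add: f)
  then show ?thesis
    using False unfolding diameter_def[of "f ` U"] by (auto intro!: cSUP_least)
qed (simp add: diameter_def)

lemma bounded_similarity_image:
  fixes f :: "'a::metric_space \<Rightarrow> 'b::metric_space"
  assumes f: "\<And>x y. dist (f x) (f y) = c * dist x y" and c: "0 < c" and U: "bounded U"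
  shows "bounded (f ` U)"
proof -
  obtain x e where "\<And>y. y \<in> U \<Longrightarrow> dist x y \<le> e"
    using U by (auto simp: bounded_def)
  then have "\<forall>z\<in>f ` U. dist (f x) z \<le> c * e"
    using c by (auto simp: f)
  then show ?thesis by (auto simp: bounded_def)
qed

lemma similarity_inv:
  fixes f :: "'a::metric_space \<Rightarrow> 'b::metric_space"
  assumes f: "\<And>x y. dist (f x) (f y) = c * dist x y" and c: "0 < c" and "surj f"
  shows "dist (inv f x) (inv f y) = 1 / c * dist x y"
  using f[of "inv f x" "inv f y"] c by (simp add: surj_f_inv_f[OF \<open>surj f\<close>])

lemma similarity_inj:
  fixes f :: "'a::metric_space \<Rightarrow> 'b::metric_space"
  assumes f: "\<And>x y. dist (f x) (f y) = c * dist x y" and c: "0 < c"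
  shows "inj f"
proof (rule injI)
  fix x y assume "f x = f y"
  then have "c * dist x y = 0" using f[of x y] by simp
  then show "x = y" using c by simp
qed

lemma diam_powr_similarity:
  fixes f :: "'a::metric_space \<Rightarrow> 'b::metric_space"
  assumes f: "\<And>x y. dist (f x) (f y) = c * dist x y" and c: "0 < c" and "surj f" and U: "bounded U"
  shows "diam_powr s (f ` U) = ennreal (c powr s) * diam_powr s U"
proof -
  have inj: "inj f" using f c by (rule similarity_inj)
  have "diameter (inv f ` f ` U) \<le> 1 / c * diameter (f ` U)"
    using c by (intro diameter_similarity_image_le similarity_inv[OF f] assms
      bounded_similarity_image[OF f]) auto
  then have "c * diameter U \<le> diameter (f ` U)"
    using c inj by (simp add: image_inv_f_f field_simps)
  with diameter_similarity_image_le[OF f c U] have "diameter (f ` U) = c * diameter U"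
    by simp
  then show ?thesis
    using c by (simp add: diam_powr_def powr_mult diameter_ge_0[OF U] flip: ennreal_mult')
qed

text \<open>The images of a cover form a cover of the image, with diameters scaled by
  \<open>c\<close>. The constant is first moved to the left, so that the claim becomes a lower bound
  for an infimum over covers.\<close>

lemma hausdorff_premeasure_similarity_le:
  fixes f :: "'a::metric_space \<Rightarrow> 'b::metric_space"
  assumes f: "\<And>x y. dist (f x) (f y) = c * dist x y" and c: "0 < c" and "surj f"
  shows "hausdorff_premeasure s (c * \<delta>) (f ` A) \<le> ennreal (c powr s) * hausdorff_premeasure s \<delta> A"
proof -
  let ?c = "c powr s"
  have "ennreal (1 / ?c) * hausdorff_premeasure s (c * \<delta>) (f ` A) \<le> hausdorff_premeasure s \<delta> A"
    unfolding hausdorff_premeasure_def[of s \<delta>]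
  proof (rule INF_greatest)
    fix U assume U: "U \<in> hausdorff_covers \<delta> A"
    have "(\<lambda>i. f ` U i) \<in> hausdorff_covers (c * \<delta>) (f ` A)"
      unfolding hausdorff_covers_def
    proof (intro CollectI conjI allI)
      show "f ` A \<subseteq> (\<Union>i. f ` U i)" using U unfolding hausdorff_covers_def by blast
      fix i
      have Ui: "bounded (U i)" "diameter (U i) \<le> \<delta>" using U by (auto simp: hausdorff_covers_def)
      show "bounded (f ` U i)" by (rule bounded_similarity_image[OF f c Ui(1)])
      have "diameter (f ` U i) \<le> c * diameter (U i)"
        by (rule diameter_similarity_image_le[OF f c Ui(1)])
      also have "\<dots> \<le> c * \<delta>" using Ui(2) c by simp
      finally show "diameter (f ` U i) \<le> c * \<delta>" .
    qed
    then have "hausdorff_premeasure s (c * \<delta>) (f ` A) \<le> (\<Sum>i. diam_powr s (f ` U i))"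
      unfolding hausdorff_premeasure_def by (rule INF_lower)
    also have "\<dots> = (\<Sum>i. ennreal ?c * diam_powr s (U i))"
      using U by (intro suminf_cong diam_powr_similarity[OF f c \<open>surj f\<close>])
        (auto simp: hausdorff_covers_def)
    finally have "hausdorff_premeasure s (c * \<delta>) (f ` A) \<le> ennreal ?c * (\<Sum>i. diam_powr s (U i))"
      by simp
    then have "ennreal (1 / ?c) * hausdorff_premeasure s (c * \<delta>) (f ` A)
        \<le> ennreal (1 / ?c) * (ennreal ?c * (\<Sum>i. diam_powr s (U i)))"
      by (rule mult_left_mono) simp
    then show "ennreal (1 / ?c) * hausdorff_premeasure s (c * \<delta>) (f ` A) \<le> (\<Sum>i. diam_powr s (U i))"
      using c by (simp add: mult.assoc[symmetric] flip: ennreal_mult')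
  qed
  then have "ennreal ?c * (ennreal (1 / ?c) * hausdorff_premeasure s (c * \<delta>) (f ` A))
      \<le> ennreal ?c * hausdorff_premeasure s \<delta> A"
    by (rule mult_left_mono) simp
  then show ?thesis
    using c by (simp add: mult.assoc[symmetric] flip: ennreal_mult')
qed

lemma hausdorff_outer_measure_similarity_le:
  fixes f :: "'a::metric_space \<Rightarrow> 'b::metric_space"
  assumes f: "\<And>x y. dist (f x) (f y) = c * dist x y" and c: "0 < c" and "surj f"
  shows "hausdorff_outer_measure s (f ` A) \<le> ennreal (c powr s) * hausdorff_outer_measure s A"
  unfolding hausdorff_outer_measure_def[of s "f ` A"]
proof (rule SUP_least)
  fix \<delta> :: real assume \<delta>: "\<delta> \<in> {0<..}"
  have "hausdorff_premeasure s (c * (\<delta> / c)) (f ` A)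
      \<le> ennreal (c powr s) * hausdorff_premeasure s (\<delta> / c) A"
    by (rule hausdorff_premeasure_similarity_le[OF f c \<open>surj f\<close>])
  also have "\<dots> \<le> ennreal (c powr s) * hausdorff_outer_measure s A"
    unfolding hausdorff_outer_measure_def using \<delta> c
    by (intro mult_left_mono SUP_upper) auto
  finally show "hausdorff_premeasure s \<delta> (f ` A) \<le> ennreal (c powr s) * hausdorff_outer_measure s A"
    using c by simp
qed

text \<open>The inequality is applied to \<open>f\<close> and to its inverse, a similarity of ratio
  \<open>1 / c\<close>.\<close>

lemma hausdorff_outer_measure_similarity:
  fixes f :: "'a::metric_space \<Rightarrow> 'b::metric_space"
  assumes f: "\<And>x y. dist (f x) (f y) = c * dist x y" and c: "0 < c" and "surj f"
  shows "hausdorff_outer_measure s (f ` A) = ennreal (c powr s) * hausdorff_outer_measure s A"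
proof (rule antisym)
  show "hausdorff_outer_measure s (f ` A) \<le> ennreal (c powr s) * hausdorff_outer_measure s A"
    by (rule hausdorff_outer_measure_similarity_le[OF assms])
  have inj: "inj f" using f c by (rule similarity_inj)
  have "hausdorff_outer_measure s (inv f ` f ` A)
      \<le> ennreal ((1 / c) powr s) * hausdorff_outer_measure s (f ` A)"
    using c inj by (intro hausdorff_outer_measure_similarity_le similarity_inv[OF f] assms
      inj_imp_surj_inv) simp_all
  then have "ennreal (c powr s) * hausdorff_outer_measure s A
      \<le> ennreal (c powr s) * (ennreal ((1 / c) powr s) * hausdorff_outer_measure s (f ` A))"
    using inj by (intro mult_left_mono) (simp_all add: image_inv_f_f)
  also have "\<dots> = hausdorff_outer_measure s (f ` A)"
    using c by (simp add: mult.assoc[symmetric] powr_divide flip: ennreal_mult')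
  finally show "ennreal (c powr s) * hausdorff_outer_measure s A \<le> hausdorff_outer_measure s (f ` A)" .
qed

section \<open>Projections, rotations and separated points\<close>

lemma proj_line_diff: "proj_line \<theta> (x - y) = proj_line \<theta> x - proj_line \<theta> y"
  by (simp add: proj_line_def inner_diff_left)

lemma proj_line_eq: "proj_line \<theta> x = x $ 1 * cos \<theta> + x $ 2 * sin \<theta>"
  by (simp add: proj_line_def inner_vec_def sum_2 vector_2)

text \<open>The source of the cocycle: rotating the points by \<open>\<alpha>\<close> amounts to
  turning the direction back by \<open>\<alpha>\<close>.\<close>

lemma proj_line_rotation: "proj_line \<theta> (rotation_by \<alpha> *v x) = proj_line (\<theta> - \<alpha>) x"
  by (simp add: proj_line_def rotation_by_def inner_vec_def matrix_vector_mult_def sum_2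
      vector_2 cos_diff sin_diff algebra_simps)

lemma norm_direction: "norm (vector [cos \<theta>, sin \<theta>] :: real^2) = 1"
  by (simp add: norm_vec_def L2_set_def sum_2 vector_2)

lemma abs_proj_line_le: "\<bar>proj_line \<theta> x\<bar> \<le> norm x"
  using Cauchy_Schwarz_ineq2[of x "vector [cos \<theta>, sin \<theta>]"] by (simp add: proj_line_def norm_direction)

lemma norm_rotation: "norm (rotation_by \<alpha> *v x) = norm x"
proof -
  have "(rotation_by \<alpha> *v x) \<bullet> (rotation_by \<alpha> *v x)
      = (x $ 1 * x $ 1 + x $ 2 * x $ 2) * ((cos \<alpha>)\<^sup>2 + (sin \<alpha>)\<^sup>2)"
    unfolding power2_eq_square
    by (simp add: rotation_by_def inner_vec_def matrix_vector_mult_def sum_2 vector_2 algebra_simps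
        del: sin_cos_squared_add3)
  also have "\<dots> = x \<bullet> x"
    by (simp only: sin_cos_squared_add2 mult_1_right) (simp add: inner_vec_def sum_2)
  finally show ?thesis by (simp add: norm_eq_sqrt_inner)
qed

lemma surj_rotation: "surj (\<lambda>x. rotation_by \<alpha> *v x)"
proof (rule linear_injective_imp_surjective[OF matrix_vector_mul_linear])
  show "inj (\<lambda>x. rotation_by \<alpha> *v x)"
    using norm_rotation[of \<alpha>] by (simp add: matrix_left_invertible_injective[symmetric]
      matrix_left_invertible_ker) (metis norm_eq_zero)
qed simp

text \<open>Opposite unit vectors span the same line; this gives \<open>max_cluster\<close> the
  period \<open>pi\<close>.\<close>

lemma proj_line_pi: "proj_line (\<theta> + pi) x = - proj_line \<theta> x"
  by (simp add: proj_line_eq)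

lemma proj_line_lipschitz: "\<bar>proj_line \<theta> x - proj_line \<phi> x\<bar> \<le> 2 * norm x * \<bar>\<theta> - \<phi>\<bar>"
proof -
  have cos: "\<bar>cos \<theta> - cos \<phi>\<bar> \<le> \<bar>\<theta> - \<phi>\<bar>" 
  proof -
    have "\<bar>cos \<theta> - cos \<phi>\<bar> = \<bar>sin ((\<theta> + \<phi>) / 2)\<bar> * (2 * \<bar>sin ((\<phi> - \<theta>) / 2)\<bar>)"
      by (simp add: cos_diff_cos abs_mult)
    also have "\<dots> \<le> 1 * (2 * \<bar>(\<phi> - \<theta>) / 2\<bar>)"
      by (intro mult_mono abs_sin_x_le_abs_x) auto
    finally show ?thesis by (simp add: abs_minus_commute)
  qed
  have sin: "\<bar>sin \<theta> - sin \<phi>\<bar> \<le> \<bar>\<theta> - \<phi>\<bar>" 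
  proof -
    have "\<bar>sin \<theta> - sin \<phi>\<bar> = (2 * \<bar>sin ((\<theta> - \<phi>) / 2)\<bar>) * \<bar>cos ((\<theta> + \<phi>) / 2)\<bar>"
      by (simp add: sin_diff_sin abs_mult)
    also have "\<dots> \<le> (2 * \<bar>(\<theta> - \<phi>) / 2\<bar>) * 1"
      by (intro mult_mono abs_sin_x_le_abs_x) auto
    finally show ?thesis by simp
  qed
  have "\<bar>proj_line \<theta> x - proj_line \<phi> x\<bar> = \<bar>x $ 1 * (cos \<theta> - cos \<phi>) + x $ 2 * (sin \<theta> - sin \<phi>)\<bar>"
    by (simp add: proj_line_eq algebra_simps)
  also have "\<dots> \<le> \<bar>x $ 1\<bar> * \<bar>cos \<theta> - cos \<phi>\<bar> + \<bar>x $ 2\<bar> * \<bar>sin \<theta> - sin \<phi>\<bar>"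
    by (metis abs_mult abs_triangle_ineq)
  also have "\<dots> \<le> norm x * \<bar>\<theta> - \<phi>\<bar> + norm x * \<bar>\<theta> - \<phi>\<bar>"
    using cos sin by (intro add_mono mult_mono component_le_norm_cart) auto
  finally show ?thesis by simp
qed

text \<open>By compactness finitely many balls of radius \<open>r / 2\<close> cover the large ball,
  and each of them contains at most one point of an \<open>r\<close>-separated set.\<close>

lemma separated_points_card_bound:
  fixes r A :: real
  assumes "0 < r"
  obtains C :: nat where "\<And>S :: 'a::euclidean_space set. S \<subseteq> cball 0 A
    \<Longrightarrow> (\<And>x y. x \<in> S \<Longrightarrow> y \<in> S \<Longrightarrow> x \<noteq> y \<Longrightarrow> r \<le> dist x y) \<Longrightarrow> finite S \<and> card S \<le> C"
proof -
  obtain T where T: "finite T" "cball 0 A \<subseteq> (\<Union>t\<in>T. ball t (r / 2) :: 'a set)"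
  proof (rule compactE_image[of "cball 0 A :: 'a set" UNIV "\<lambda>t. ball t (r / 2)"])
    show "cball 0 A \<subseteq> (\<Union>c. ball c (r / 2) :: 'a set)"
      using assms by (meson UNIV_I UN_I centre_in_ball half_gt_zero subsetI)
  qed auto
  show thesis
  proof (rule that[of "card T"])
    fix S :: "'a set" assume S: "S \<subseteq> cball 0 A"
      and sep: "\<And>x y. x \<in> S \<Longrightarrow> y \<in> S \<Longrightarrow> x \<noteq> y \<Longrightarrow> r \<le> dist x y"
    have "\<forall>x\<in>S. \<exists>t\<in>T. x \<in> ball t (r / 2)" using S T(2) by blast
    then obtain g where g: "\<And>x. x \<in> S \<Longrightarrow> g x \<in> T" "\<And>x. x \<in> S \<Longrightarrow> dist (g x) x < r / 2"
      by (metis mem_ball)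
    have "inj_on g S"
    proof (rule inj_onI, rule ccontr)
      fix x y assume xy: "x \<in> S" "y \<in> S" "g x = g y" "x \<noteq> y"
      have "dist x y \<le> dist (g x) x + dist (g y) y"
        using xy(3) by (metis dist_commute dist_triangle)
      then show False using sep[OF xy(1,2,4)] g(2)[of x] g(2)[of y] xy by linarith
    qed
    moreover have "g ` S \<subseteq> T" using g by auto
    ultimately show "finite S \<and> card S \<le> card T"
      using T(1) by (meson card_inj_on_le finite_subset inj_on_finite)
  qed
qed

section \<open>Clusters of words\<close>

text \<open>The base point \<open>p\<close> marks the position of each piece of \<open>K\<close>. In
  the condition on \<open>D\<close>, the \<open>4 * R\<close> pays for moving base points inside two
  pieces and the 2 for the width of a strip; the factor \<open>1 - \<rho>\<close> lets clusters pass
  to their prefixes.\<close>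

locale planar_ifs =
  fixes \<Lambda> :: "'i set" and h :: "'i \<Rightarrow> real^2 \<Rightarrow> real^2" and \<rho> \<alpha> R D :: real
    and K :: "(real^2) set" and p :: "real^2"
  assumes ifs: "homogeneous_ifs \<rho> \<alpha> \<Lambda> h" and lim: "is_limit_set \<Lambda> h K"
    and p: "p \<in> K" and R: "\<And>x. x \<in> K \<Longrightarrow> norm x \<le> R" "0 < R"
    and D: "2 + 4 * R \<le> (1 - \<rho>) * D"
begin

lemma \<rho>: "0 < \<rho>" "\<rho> < 1" and finite_\<Lambda>: "finite \<Lambda>" and \<Lambda>_nonempty: "\<Lambda> \<noteq> {}"
  using ifs by (auto simp: homogeneous_ifs_def)

lemma D_pos: "0 < D" and D_ge: "2 + 4 * R \<le> D"
proof -
  have "0 < (1 - \<rho>) * D" using D R(2) by linarith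
  then show D0: "0 < D" using \<rho> by (simp add: zero_less_mult_iff)
  have "(1 - \<rho>) * D \<le> D" using \<rho> D0 by (simp add: mult_le_cancel_right1)
  then show "2 + 4 * R \<le> D" using D by linarith
qed

lemma map_eq: "\<exists>b. \<forall>i\<in>\<Lambda>. \<forall>x. h i x = \<rho> *\<^sub>R (rotation_by \<alpha> *v x) + b i"
  using ifs by (auto simp: homogeneous_ifs_def)

lemma map_diff:
  assumes "i \<in> \<Lambda>"
  shows "h i x - h i y = \<rho> *\<^sub>R (rotation_by \<alpha> *v (x - y))"
  using map_eq assms by (auto simp: matrix_vector_mult_diff_distrib scaleR_diff_right)

lemma dist_map: "i \<in> \<Lambda> \<Longrightarrow> dist (h i x) (h i y) = \<rho> * dist x y"
  using \<rho> by (simp add: dist_norm map_diff norm_rotation)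

lemma proj_map:
  "i \<in> \<Lambda> \<Longrightarrow> proj_line \<theta> (h i x) - proj_line \<theta> (h i y)
     = \<rho> * (proj_line (\<theta> - \<alpha>) x - proj_line (\<theta> - \<alpha>) y)"
  unfolding proj_line_diff[symmetric] map_diff proj_line_rotation[of \<theta> \<alpha>, symmetric]
  by (simp only: proj_line_def inner_scaleR_left matrix_vector_mult_diff_distrib)

lemma surj_map:
  assumes "i \<in> \<Lambda>"
  shows "surj (h i)"
  unfolding surj_def
proof
  fix y
  obtain b where b: "\<And>x. h i x = \<rho> *\<^sub>R (rotation_by \<alpha> *v x) + b i"
    using map_eq assms by blast
  obtain x where "rotation_by \<alpha> *v x = (1 / \<rho>) *\<^sub>R (y - b i)"
    using surj_rotation[of \<alpha>] by (metis surjD)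
  then have "y = h i x" using \<rho> by (simp add: b)
  then show "\<exists>x. y = h i x" ..
qed

section \<open>Words and the pieces of the limit set\<close>

lemma dist_word: "set w \<subseteq> \<Lambda> \<Longrightarrow> dist (foldr h w x) (foldr h w y) = \<rho> ^ length w * dist x y"
  by (induction w) (auto simp: dist_map)

lemma surj_word: "set w \<subseteq> \<Lambda> \<Longrightarrow> surj (foldr h w)"
proof (induction w)
  case (Cons i w)
  then have "surj (h i \<circ> foldr h w)" by (intro comp_surj surj_map) auto
  then show ?case by (simp add: comp_def)
qed (simp add: id_def[symmetric])

text \<open>Each letter contributes a factor \<open>\<rho>\<close> and turns the direction by
  \<open>-\<alpha>\<close>. The translations cancel in the difference, so only the length of the
  word matters.\<close>

lemma proj_word:
  "set w \<subseteq> \<Lambda> \<Longrightarrow> proj_line \<theta> (foldr h w x) - proj_line \<theta> (foldr h w y)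
     = \<rho> ^ length w * (proj_line (\<theta> - real (length w) * \<alpha>) x - proj_line (\<theta> - real (length w) * \<alpha>) y)"
proof (induction w arbitrary: \<theta>)
  case (Cons i w)
  have angle: "\<theta> - \<alpha> - real (length w) * \<alpha> = \<theta> - real (length (i # w)) * \<alpha>"
    by (simp add: algebra_simps)
  have "proj_line \<theta> (foldr h (i # w) x) - proj_line \<theta> (foldr h (i # w) y)
      = \<rho> * (proj_line (\<theta> - \<alpha>) (foldr h w x) - proj_line (\<theta> - \<alpha>) (foldr h w y))"
    using Cons.prems by (simp add: proj_map)
  then show ?case unfolding angle[symmetric] using Cons by (simp add: mult.assoc)
qed simp

text \<open>A word acts through \<open>foldr h w\<close>, its first letter being the outermost map.
  A prefix thus names a larger piece that contains the piece of the whole word.\<close>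

definition words :: "nat \<Rightarrow> 'i list set" where
  "words n = {w. set w \<subseteq> \<Lambda> \<and> length w = n}"

lemma finite_words: "finite (words n)"
  unfolding words_def by (rule finite_lists_length_eq[OF finite_\<Lambda>])

lemma card_words: "card (words n) = card \<Lambda> ^ n"
  unfolding words_def by (rule card_lists_length_eq[OF finite_\<Lambda>])

lemma words_Suc: "words (Suc n) = (\<lambda>(i, w). i # w) ` (\<Lambda> \<times> words n)"
  by (force simp: words_def length_Suc_conv)

lemma limit_set_eq: "K = (\<Union>i\<in>\<Lambda>. h i ` K)"
  using lim by (simp add: is_limit_set_def)

lemma limit_set_words: "K = (\<Union>w\<in>words n. foldr h w ` K)"
proof (induction n)
  case (Suc n)
  have "(\<Union>w\<in>words (Suc n). foldr h w ` K) = (\<Union>i\<in>\<Lambda>. h i ` (\<Union>w\<in>words n. foldr h w ` K))"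
    unfolding words_Suc by (auto simp: image_iff) blast+
  also have "\<dots> = K" using Suc limit_set_eq by simp
  finally show ?case ..
qed (simp add: words_def)

lemma word_in_limit_set: "w \<in> words n \<Longrightarrow> x \<in> K \<Longrightarrow> foldr h w x \<in> K"
  using limit_set_words[of n] by blast

lemma dist_limit_set: "x \<in> K \<Longrightarrow> y \<in> K \<Longrightarrow> dist x y \<le> 2 * R"
  using R(1)[of x] R(1)[of y] norm_triangle_ineq4[of x y] by (simp add: dist_norm)

lemma proj_word_piece:
  assumes "w \<in> words n" "x \<in> K" "y \<in> K"
  shows "\<bar>proj_line \<theta> (foldr h w x) - proj_line \<theta> (foldr h w y)\<bar> \<le> 2 * R * \<rho> ^ n"
proof -
  have "\<bar>proj_line \<theta> (foldr h w x) - proj_line \<theta> (foldr h w y)\<bar> \<le> dist (foldr h w x) (foldr h w y)"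
    unfolding proj_line_diff[symmetric] dist_norm by (rule abs_proj_line_le)
  also have "\<dots> = \<rho> ^ n * dist x y" using assms by (simp add: words_def dist_word)
  also have "\<dots> \<le> \<rho> ^ n * (2 * R)"
    using \<rho> dist_limit_set[OF assms(2,3)] by (intro mult_left_mono) auto
  finally show ?thesis by (simp add: mult_ac)
qed

text \<open>The width \<open>D * \<rho>\<^sup>n\<close> is chosen so that the prefixes of a cluster again form a cluster; this makes
  \<open>max_cluster\<close> submultiplicative without a constant.\<close>

definition clusters :: "nat \<Rightarrow> real \<Rightarrow> 'i list set set" where
  "clusters n \<theta> = {W. W \<subseteq> words n \<and>
     (\<forall>v\<in>W. \<forall>w\<in>W. \<bar>proj_line \<theta> (foldr h v p) - proj_line \<theta> (foldr h w p)\<bar> \<le> D * \<rho> ^ n)}"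

definition max_cluster :: "nat \<Rightarrow> real \<Rightarrow> nat" where
  "max_cluster n \<theta> = Max (card ` clusters n \<theta>)"

lemma finite_clusters: "finite (clusters n \<theta>)"
  by (rule finite_subset[of _ "Pow (words n)"]) (auto simp: clusters_def finite_words)

lemma singleton_cluster: "w \<in> words n \<Longrightarrow> {w} \<in> clusters n \<theta>"
  using D_pos \<rho> by (simp add: clusters_def)

lemma words_nonempty: "words n \<noteq> {}"
proof -
  obtain i where "i \<in> \<Lambda>" using \<Lambda>_nonempty by auto
  then have "replicate n i \<in> words n" by (auto simp: words_def)
  then show ?thesis by auto
qed

lemma card_le_max_cluster: "W \<in> clusters n \<theta> \<Longrightarrow> card W \<le> max_cluster n \<theta>"
  unfolding max_cluster_def by (intro Max_ge finite_imageI finite_clusters imageI)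

lemma max_cluster_attained:
  obtains W where "W \<in> clusters n \<theta>" "card W = max_cluster n \<theta>"
proof -
  have "clusters n \<theta> \<noteq> {}" using singleton_cluster words_nonempty by blast
  then have "max_cluster n \<theta> \<in> card ` clusters n \<theta>"
    unfolding max_cluster_def by (intro Max_in finite_imageI finite_clusters) auto
  then show thesis using that by auto
qed

lemma max_cluster_ge_1: "1 \<le> max_cluster n \<theta>"
  using card_le_max_cluster[OF singleton_cluster] words_nonempty by fastforce

lemma max_cluster_le: "max_cluster n \<theta> \<le> card \<Lambda> ^ n"
  by (rule max_cluster_attained[of n \<theta>])
    (metis (no_types, lifting) card_mono card_words clusters_def finite_words mem_Collect_eq)

lemma max_cluster_periodic: "max_cluster n (\<theta> + pi) = max_cluster n \<theta>"
proof -
  have "clusters n (\<theta> + pi) = clusters n \<theta>"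
    unfolding clusters_def proj_line_pi by (simp add: abs_minus_commute)
  then show ?thesis by (simp add: max_cluster_def)
qed

text \<open>The words of a largest cluster of level \<open>m + n\<close> are sorted by their
  prefixes of length \<open>m\<close>. The prefixes form a cluster of level \<open>m\<close>; the
  suffixes behind one fixed prefix form a cluster of level \<open>n\<close> for the direction turned
  by \<open>m\<close> steps.\<close>

lemma max_cluster_submult:
  "max_cluster (m + n) \<theta> \<le> max_cluster m \<theta> * max_cluster n (\<theta> - real m * \<alpha>)"
\<comment> \<open>Only for \<open>n > 0\<close> is \<open>\<rho> ^ n \<le> \<rho>\<close>, which the
  passage to prefixes uses.\<close>
proof (cases "n = 0")
  case True
  then show ?thesis using max_cluster_ge_1[of 0 "\<theta> - real m * \<alpha>"] by simp
next
  case False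
  obtain W where W: "W \<in> clusters (m + n) \<theta>" "card W = max_cluster (m + n) \<theta>"
    by (rule max_cluster_attained)
  have finW: "finite W" using W(1) finite_words by (auto simp: clusters_def intro: finite_subset)
  have W_words: "take m w \<in> words m" "drop m w \<in> words n" if "w \<in> W" for w
    using that W(1) set_take_subset[of m w] set_drop_subset[of m w] by (auto simp: clusters_def words_def)
  have close: "\<bar>proj_line \<theta> (foldr h v p) - proj_line \<theta> (foldr h w p)\<bar> \<le> D * \<rho> ^ (m + n)"
    if "v \<in> W" "w \<in> W" for v w
    using that W(1) by (auto simp: clusters_def)
  have split: "foldr h w p = foldr h (take m w) (foldr h (drop m w) p)" for w
    by (metis append_take_drop_id comp_apply foldr_append)
  have "take m ` W \<in> clusters m \<theta>"
    unfolding clusters_def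
  proof (intro CollectI conjI ballI)
    show "take m ` W \<subseteq> words m" using W_words by auto
    fix v' w' assume "v' \<in> take m ` W" "w' \<in> take m ` W"
    then obtain v w where vw: "v \<in> W" "w \<in> W" "v' = take m v" "w' = take m w" by auto
    \<comment> \<open>The prefix maps both \<open>p\<close> and the suffix image of
      \<open>p\<close>, which lies in \<open>K\<close>, into its own piece.\<close>
    have piece: "\<bar>proj_line \<theta> (foldr h (take m u) p) - proj_line \<theta> (foldr h u p)\<bar> \<le> 2 * R * \<rho> ^ m"
      if "u \<in> W" for u
      unfolding split[of u]
      by (intro proj_word_piece W_words(1) that p word_in_limit_set[OF W_words(2)])
    have "\<bar>proj_line \<theta> (foldr h v' p) - proj_line \<theta> (foldr h w' p)\<bar>
        \<le> 4 * R * \<rho> ^ m + D * \<rho> ^ (m + n)"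
      using piece[OF vw(1)] piece[OF vw(2)] close[OF vw(1,2)] unfolding vw(3,4) by linarith
    also have "\<dots> = (4 * R + D * \<rho> ^ n) * \<rho> ^ m" by (simp add: power_add algebra_simps)
    also have "\<dots> \<le> D * \<rho> ^ m"
    proof (rule mult_right_mono)
      have "\<rho> ^ n \<le> \<rho>" using \<rho> False power_decreasing[of 1 n \<rho>] by simp
      then have "D * \<rho> ^ n \<le> D * \<rho>" using D_pos by simp
      then show "4 * R + D * \<rho> ^ n \<le> D" using D by (simp add: algebra_simps)
    qed (use \<rho> in simp)
    finally show "\<bar>proj_line \<theta> (foldr h v' p) - proj_line \<theta> (foldr h w' p)\<bar> \<le> D * \<rho> ^ m" .
  qed
  then have card_pre: "card (take m ` W) \<le> max_cluster m \<theta>" by (rule card_le_max_cluster)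
  have card_suf: "card {w \<in> W. take m w = u} \<le> max_cluster n (\<theta> - real m * \<alpha>)"
    if u: "u \<in> take m ` W" for u
  proof -
    have u_words: "u \<in> words m" using u W_words by auto
    let ?S = "{w \<in> W. take m w = u}"
    have "inj_on (drop m) ?S"
      by (rule inj_onI) (metis (mono_tags, lifting) append_take_drop_id mem_Collect_eq)
    then have "card ?S = card (drop m ` ?S)" by (simp add: card_image)
    also have "drop m ` ?S \<in> clusters n (\<theta> - real m * \<alpha>)"
      unfolding clusters_def
    proof (intro CollectI conjI ballI)
      show "drop m ` ?S \<subseteq> words n" using W_words by auto
      fix v' w' assume "v' \<in> drop m ` ?S" "w' \<in> drop m ` ?S"
      then obtain v w where vw: "v \<in> W" "w \<in> W" "v' = drop m v" "w' = drop m w"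
        "take m v = u" "take m w = u" by auto
      \<comment> \<open>The two words share the prefix \<open>u\<close>; removing it magnifies the
        difference by \<open>1 / \<rho> ^ m\<close> and turns the direction.\<close>
      have "proj_line \<theta> (foldr h v p) - proj_line \<theta> (foldr h w p)
          = \<rho> ^ m * (proj_line (\<theta> - real m * \<alpha>) (foldr h v' p) - proj_line (\<theta> - real m * \<alpha>) (foldr h w' p))"
        unfolding split[of v] split[of w] vw(3-6)
        using u_words by (simp add: words_def proj_word)
      then have "\<rho> ^ m * \<bar>proj_line (\<theta> - real m * \<alpha>) (foldr h v' p) - proj_line (\<theta> - real m * \<alpha>) (foldr h w' p)\<bar>
          \<le> \<rho> ^ m * (D * \<rho> ^ n)"
        using close[OF vw(1,2)] \<rho> by (simp add: abs_mult power_add mult_ac)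
      then show "\<bar>proj_line (\<theta> - real m * \<alpha>) (foldr h v' p) - proj_line (\<theta> - real m * \<alpha>) (foldr h w' p)\<bar>
          \<le> D * \<rho> ^ n"
        using \<rho> by simp
    qed
    then have "card (drop m ` ?S) \<le> max_cluster n (\<theta> - real m * \<alpha>)" by (rule card_le_max_cluster)
    finally show ?thesis .
  qed
  have "card W = (\<Sum>u\<in>take m ` W. card {w \<in> W. take m w = u})"
    using sum.image_gen[OF finW, of "\<lambda>_. 1::nat" "take m"] by simp
  also have "\<dots> \<le> card (take m ` W) * max_cluster n (\<theta> - real m * \<alpha>)"
    using sum_bounded_above[of "take m ` W" _ "max_cluster n (\<theta> - real m * \<alpha>)"] card_suf by auto
  also have "\<dots> \<le> max_cluster m \<theta> * max_cluster n (\<theta> - real m * \<alpha>)"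
    using card_pre by (rule mult_right_mono) simp
  finally show ?thesis by (simp add: W(2))
qed

text \<open>Turning the direction by a small angle at most doubles the width of a cluster, and a cluster
  of double width splits into two clusters.\<close>

lemma max_cluster_coarsely_continuous:
  "\<exists>\<delta>>0. \<forall>\<theta> \<phi>. \<bar>\<theta> - \<phi>\<bar> < \<delta> \<longrightarrow> max_cluster n \<theta> \<le> 2 * max_cluster n \<phi>"
proof (intro exI conjI allI impI)
  \<comment> \<open>Base points of words are at distance at most \<open>2 * R\<close>, so by
    \<open>proj_line_lipschitz\<close> their projected difference changes by at most
    \<open>4 * R\<close> times the angle, hence by at most \<open>D * \<rho> ^ n\<close>.\<close>
  show "0 < D * \<rho> ^ n / (4 * R)" using D_pos \<rho> R(2) by simp
  fix \<theta> \<phi> :: real assume \<delta>: "\<bar>\<theta> - \<phi>\<bar> < D * \<rho> ^ n / (4 * R)"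
  obtain W where W: "W \<in> clusters n \<theta>" "card W = max_cluster n \<theta>"
    by (rule max_cluster_attained)
  have finW: "finite W" using W(1) finite_words by (auto simp: clusters_def intro: finite_subset)
  have W0: "W \<noteq> {}" using W(2) max_cluster_ge_1[of n \<theta>] by auto
  define t where "t w = proj_line \<phi> (foldr h w p)" for w
  have t_close: "t v - t w \<le> 2 * (D * \<rho> ^ n)" if vw: "v \<in> W" "w \<in> W" for v w
  proof -
    let ?d = "foldr h v p - foldr h w p"
    have vw': "v \<in> words n" "w \<in> words n" using vw W(1) by (auto simp: clusters_def)
    have "norm ?d \<le> 2 * R"
      using dist_limit_set[OF word_in_limit_set[OF vw'(1) p] word_in_limit_set[OF vw'(2) p]]
      by (simp add: dist_norm)
    have "\<bar>proj_line \<theta> ?d - proj_line \<phi> ?d\<bar> \<le> 2 * norm ?d * \<bar>\<theta> - \<phi>\<bar>"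
      by (rule proj_line_lipschitz)
    also have "\<dots> \<le> (2 * (2 * R)) * (D * \<rho> ^ n / (4 * R))"
      using \<open>norm ?d \<le> 2 * R\<close> \<delta> R(2) by (intro mult_mono) auto
    also have "\<dots> = D * \<rho> ^ n" using R(2) by simp
    finally have "\<bar>proj_line \<theta> ?d - proj_line \<phi> ?d\<bar> \<le> D * \<rho> ^ n" .
    moreover have "\<bar>proj_line \<theta> ?d\<bar> \<le> D * \<rho> ^ n"
      using W(1) vw by (auto simp: clusters_def proj_line_diff)
    moreover have "t v - t w = proj_line \<phi> ?d" by (simp add: t_def proj_line_diff)
    ultimately show ?thesis by linarith
  qed
  define t0 where "t0 = Min (t ` W)"
  have t0: "t0 \<le> t w" if "w \<in> W" for w using that finW by (simp add: t0_def)
  have "t0 \<in> t ` W" unfolding t0_def using finW W0 by (intro Min_in) auto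
  then have t1: "t w \<le> t0 + 2 * (D * \<rho> ^ n)" if "w \<in> W" for w using t_close[OF that] by force
  define W1 W2 where "W1 = {w \<in> W. t w \<le> t0 + D * \<rho> ^ n}" and "W2 = {w \<in> W. t0 + D * \<rho> ^ n < t w}"
  have "W1 \<in> clusters n \<phi>" "W2 \<in> clusters n \<phi>"
    using W(1) t0 t1 by (auto simp: clusters_def W1_def W2_def t_def[symmetric] abs_le_iff) (smt (verit))+
  then have "card W1 \<le> max_cluster n \<phi>" "card W2 \<le> max_cluster n \<phi>"
    by (simp_all add: card_le_max_cluster)
  moreover have "card W \<le> card W1 + card W2"
  proof -
    have "W = W1 \<union> W2" by (auto simp: W1_def W2_def)
    then show ?thesis by (metis card_Un_le)
  qed
  ultimately show "max_cluster n \<theta> \<le> 2 * max_cluster n \<phi>" using W(2) by simp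
qed

text \<open>For a fixed set \<open>W\<close> of words, the directions for which it is a cluster form
  a closed set. Superlevel sets of \<open>max_cluster\<close> are finite unions of such
  sets.\<close>

lemma max_cluster_measurable: "(\<lambda>\<theta>. real (max_cluster n \<theta>)) \<in> borel_measurable borel"
  unfolding borel_measurable_iff_ge
proof
  fix a :: real
  let ?A = "{W. W \<subseteq> words n \<and> a \<le> real (card W)}"
  have "{\<theta> \<in> space borel. a \<le> real (max_cluster n \<theta>)} = (\<Union>W\<in>?A. {\<theta>. W \<in> clusters n \<theta>})"
  proof (intro equalityI subsetI)
    fix \<theta> assume "\<theta> \<in> {\<theta> \<in> space borel. a \<le> real (max_cluster n \<theta>)}"
    then show "\<theta> \<in> (\<Union>W\<in>?A. {\<theta>. W \<in> clusters n \<theta>})"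
      by (cases rule: max_cluster_attained[of n \<theta>]) (auto simp: clusters_def)
  next
    fix \<theta> assume "\<theta> \<in> (\<Union>W\<in>?A. {\<theta>. W \<in> clusters n \<theta>})"
    then show "\<theta> \<in> {\<theta> \<in> space borel. a \<le> real (max_cluster n \<theta>)}"
      using card_le_max_cluster[of _ n \<theta>] by force
  qed
  moreover have "closed {\<theta>. W \<in> clusters n \<theta>}" if "W \<subseteq> words n" for W
  proof -
    have "{\<theta>. W \<in> clusters n \<theta>} = (\<Inter>v\<in>W. \<Inter>w\<in>W.
        {\<theta>. \<bar>proj_line \<theta> (foldr h v p) - proj_line \<theta> (foldr h w p)\<bar> \<le> D * \<rho> ^ n})"
      using that by (auto simp: clusters_def)
    moreover have "closed {\<theta>. \<bar>proj_line \<theta> x - proj_line \<theta> y\<bar> \<le> c}" for x y c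
      unfolding proj_line_eq by (intro closed_Collect_le continuous_intros)
    ultimately show ?thesis by (simp add: closed_INT)
  qed
  moreover have "finite ?A" using finite_words by simp
  ultimately show "{\<theta> \<in> space borel. a \<le> real (max_cluster n \<theta>)} \<in> sets borel"
    by (auto intro!: borel_closed closed_UN)
qed

end

section \<open>Bounded overlap and the Hausdorff measure of strips\<close>

lemma hausdorff_outer_measure_finite_UN_le:
  "finite I \<Longrightarrow> hausdorff_outer_measure s (\<Union>i\<in>I. A i) \<le> (\<Sum>i\<in>I. hausdorff_outer_measure s (A i))"
proof (induction I rule: finite_induct)
  case (insert i I)
  have "hausdorff_outer_measure s (\<Union>j\<in>insert i I. A j)
      \<le> hausdorff_outer_measure s (A i) + hausdorff_outer_measure s (\<Union>j\<in>I. A j)"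
    using hausdorff_outer_measure_Un_le[of s "A i" "\<Union>j\<in>I. A j"] by simp
  also have "\<dots> \<le> (\<Sum>j\<in>insert i I. hausdorff_outer_measure s (A j))"
    using insert by (simp add: add_left_mono)
  finally show ?case .
qed simp

context planar_ifs
begin

text \<open>Distinct words of length \<open>n\<close> move a fixed point of the open set to \<open>\<rho>\<^sup>n\<close>-separated points.\<close>

lemma bounded_overlap:
  assumes "open_set_condition \<Lambda> h"
  obtains C :: nat where "0 < C" "\<And>n x. card {w \<in> words n. x \<in> foldr h w ` K} \<le> C"
proof -
  obtain U where U: "open U" "U \<noteq> {}" "\<forall>i\<in>\<Lambda>. h i ` U \<subseteq> U"
    and disj: "\<forall>i\<in>\<Lambda>. \<forall>j\<in>\<Lambda>. i \<noteq> j \<longrightarrow> h i ` U \<inter> h j ` U = {}"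
    using assms unfolding open_set_condition_def by metis
  obtain z r where z: "0 < r" "ball z r \<subseteq> U"
    using U(1,2) by (metis ex_in_conv open_contains_ball)
  have word_U: "foldr h w x \<in> U" if "set w \<subseteq> \<Lambda>" "x \<in> U" for w x
    using that U(3) by (induction w) auto
  \<comment> \<open>Common first letters are cancelled by injectivity; at the first differing letter
    the images of \<open>U\<close> are disjoint.\<close>
  have word_disj: "foldr h v x \<noteq> foldr h w y"
    if "v \<in> words n" "w \<in> words n" "v \<noteq> w" "x \<in> U" "y \<in> U" for n v w x y
    using that
  proof (induction n arbitrary: v w)
    case (Suc n)
    then obtain i v' j w' where *: "v = i # v'" "w = j # w'" "i \<in> \<Lambda>" "j \<in> \<Lambda>"
      "v' \<in> words n" "w' \<in> words n" by (auto simp: words_Suc)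
    show ?case
    proof (cases "i = j")
      case True
      have "inj (h i)" using dist_map[OF *(3)] \<rho>(1) by (rule similarity_inj)
      then show ?thesis using Suc * True by (auto dest: injD)
    next
      case False
      have "foldr h v' x \<in> U" "foldr h w' y \<in> U"
        using * Suc.prems by (auto simp: words_def intro: word_U)
      then show ?thesis using disj[rule_format, OF *(3,4) False] * by auto
    qed
  qed (simp add: words_def)
  have sep: "\<rho> ^ n * r \<le> dist (foldr h v z) (foldr h w z)"
    if vw: "v \<in> words n" "w \<in> words n" "v \<noteq> w" for n v w
  proof (rule ccontr)
    \<comment> \<open>Otherwise the image of \<open>z\<close> under \<open>w\<close> would be the
      image under \<open>v\<close> of a point in the ball around \<open>z\<close>, hence in
      \<open>U\<close>, against \<open>word_disj\<close>.\<close>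
    assume less: "\<not> ?thesis"
    have v: "set v \<subseteq> \<Lambda>" "length v = n" using vw by (auto simp: words_def)
    obtain y where y: "foldr h w z = foldr h v y" using surj_word[OF v(1)] by (metis surjD)
    have "\<rho> ^ n * dist z y < \<rho> ^ n * r" using less unfolding y dist_word[OF v(1)] v(2) by simp
    then have "y \<in> U" using \<rho> z(2) by auto
    moreover have "z \<in> U" using z by auto
    ultimately show False using word_disj[OF vw(2,1)] vw(3) y by metis
  qed
  obtain C :: nat where C: "\<And>S :: (real^2) set. S \<subseteq> cball 0 (norm z + R)
    \<Longrightarrow> (\<And>x y. x \<in> S \<Longrightarrow> y \<in> S \<Longrightarrow> x \<noteq> y \<Longrightarrow> r \<le> dist x y) \<Longrightarrow> finite S \<and> card S \<le> C"
    using separated_points_card_bound[OF z(1)] by blast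
  have "card {w \<in> words n. x \<in> foldr h w ` K} \<le> Suc C" for n x
  proof -
    let ?W = "{w \<in> words n. x \<in> foldr h w ` K}"
    \<comment> \<open>Magnification by \<open>1 / \<rho> ^ n\<close> about \<open>x\<close>: the
      images of \<open>z\<close> under words whose pieces contain \<open>x\<close> become
      \<open>r\<close>-separated and stay in a ball of radius independent of \<open>n\<close> and
      \<open>x\<close>.\<close>
    define q where "q w = (1 / \<rho> ^ n) *\<^sub>R (foldr h w z - x)" for w
    have q_sep: "r \<le> dist (q v) (q w)" if "v \<in> ?W" "w \<in> ?W" "v \<noteq> w" for v w
    proof -
      have "dist (q v) (q w) = dist (foldr h v z) (foldr h w z) / \<rho> ^ n"
        using \<rho> by (simp add: q_def dist_norm scaleR_diff_right[symmetric] divide_inverse_commute)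
      then show ?thesis using sep[of v n w] that \<rho> by (simp add: pos_le_divide_eq mult.commute)
    qed
    have "q ` ?W \<subseteq> cball 0 (norm z + R)"
    proof
      fix y assume "y \<in> q ` ?W"
      then obtain w k where w: "w \<in> words n" "k \<in> K" "x = foldr h w k" "y = q w" by auto
      have "norm y = dist (foldr h w z) (foldr h w k) / \<rho> ^ n"
        using \<rho> w by (simp add: q_def dist_norm divide_inverse_commute)
      also have "\<dots> = dist z k" using w \<rho> by (simp add: words_def dist_word)
      also have "\<dots> \<le> norm z + R"
        using R(1)[OF w(2)] norm_triangle_ineq4[of z k] by (simp add: dist_norm)
      finally show "y \<in> cball 0 (norm z + R)" by simp
    qed
    moreover have "r \<le> dist y y'" if yy: "y \<in> q ` ?W" "y' \<in> q ` ?W" "y \<noteq> y'" for y y'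
    proof -
      obtain v where v: "y = q v" "v \<in> ?W" by (rule imageE[OF yy(1)])
      obtain w where w: "y' = q w" "w \<in> ?W" by (rule imageE[OF yy(2)])
      have "v \<noteq> w" using yy(3) v(1) w(1) by (metis (no_types))
      then show ?thesis unfolding v(1) w(1) by (rule q_sep[OF v(2) w(2)])
    qed
    ultimately have "card (q ` ?W) \<le> C"
      by (rule C[THEN conjunct2])
    moreover have "inj_on q ?W"
    proof (rule inj_onI, rule ccontr)
      fix v w assume "v \<in> ?W" "w \<in> ?W" "q v = q w" "v \<noteq> w"
      then show False using q_sep[of v w] z(1) by simp
    qed
    ultimately show ?thesis by (simp add: card_image)
  qed
  \<comment> \<open>The successor makes the bound positive, so that it can be divided by
    later.\<close>
  then show thesis using that[of "Suc C"] by simp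
qed

lemma hausdorff_piece:
  assumes "w \<in> words n"
  shows "hausdorff_outer_measure s (foldr h w ` K) = ennreal ((\<rho> ^ n) powr s) * hausdorff_outer_measure s K"
  using assms \<rho> by (intro hausdorff_outer_measure_similarity surj_word) (auto simp: words_def dist_word)

lemma borel_piece:
  assumes "w \<in> words n"
  shows "foldr h w ` K \<in> sets borel"
proof -
  have "(\<rho> ^ n)-lipschitz_on K (foldr h w)"
    using assms \<rho> by (intro lipschitz_onI) (auto simp: words_def dist_word)
  then have "compact (foldr h w ` K)"
    using lim by (intro compact_continuous_image lipschitz_on_continuous_on) (auto simp: is_limit_set_def)
  then show ?thesis by (rule borel_compact)
qed

text \<open>The words whose pieces meet the strip form a cluster because
  \<open>2 + 4 * R \<le> D\<close>, and these pieces cover the part of \<open>K\<close> in the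
  strip.\<close>

lemma hausdorff_strip_le:
  assumes S: "\<And>x. x \<in> S \<Longrightarrow> \<bar>proj_line \<theta> x - c\<bar> \<le> \<rho> ^ n"
  shows "hausdorff_outer_measure s (S \<inter> K)
    \<le> of_nat (max_cluster n \<theta>) * (ennreal ((\<rho> ^ n) powr s) * hausdorff_outer_measure s K)"
proof -
  let ?W = "{w \<in> words n. foldr h w ` K \<inter> S \<noteq> {}}"
  have "?W \<in> clusters n \<theta>"
    unfolding clusters_def
  proof (intro CollectI conjI ballI)
    have near: "\<bar>proj_line \<theta> (foldr h w p) - c\<bar> \<le> (2 * R + 1) * \<rho> ^ n" if w: "w \<in> ?W" for w
    proof -
      obtain k where "k \<in> K" "foldr h w k \<in> S" using w by auto
      then show ?thesis
        using proj_word_piece[of w n p k \<theta>] w p S[of "foldr h w k"] by (simp add: algebra_simps)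
    qed
    fix v w assume "v \<in> ?W" "w \<in> ?W"
    then have "\<bar>proj_line \<theta> (foldr h v p) - proj_line \<theta> (foldr h w p)\<bar> \<le> (2 + 4 * R) * \<rho> ^ n"
      using near[of v] near[of w] by (simp add: algebra_simps)
    also have "\<dots> \<le> D * \<rho> ^ n" using D_ge \<rho> by (intro mult_right_mono) auto
    finally show "\<bar>proj_line \<theta> (foldr h v p) - proj_line \<theta> (foldr h w p)\<bar> \<le> D * \<rho> ^ n" .
  qed auto
  then have card: "card ?W \<le> max_cluster n \<theta>" by (rule card_le_max_cluster)
  have "S \<inter> K \<subseteq> (\<Union>w\<in>?W. foldr h w ` K)"
    using limit_set_words[of n] by blast
  then have "hausdorff_outer_measure s (S \<inter> K) \<le> hausdorff_outer_measure s (\<Union>w\<in>?W. foldr h w ` K)"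
    by (rule hausdorff_outer_measure_mono)
  also have "\<dots> \<le> (\<Sum>w\<in>?W. hausdorff_outer_measure s (foldr h w ` K))"
    using finite_words by (intro hausdorff_outer_measure_finite_UN_le) simp
  also have "\<dots> = (\<Sum>w\<in>?W. ennreal ((\<rho> ^ n) powr s) * hausdorff_outer_measure s K)"
    by (intro sum.cong hausdorff_piece) auto
  also have "\<dots> = of_nat (card ?W) * (ennreal ((\<rho> ^ n) powr s) * hausdorff_outer_measure s K)"
    by simp
  also have "\<dots> \<le> of_nat (max_cluster n \<theta>) * (ennreal ((\<rho> ^ n) powr s) * hausdorff_outer_measure s K)"
    using card by (intro mult_right_mono) (auto simp: of_nat_mono)
  finally show ?thesis .
qed

text \<open>All pieces of a largest cluster lie in one strip. The sum of their indicator functions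
  is at most \<open>C\<close> on their union, so integration bounds the sum of their measures by
  \<open>C\<close> times the measure of the strip.\<close>

lemma hausdorff_strip_ge:
  assumes C: "\<And>x. card {w \<in> words n. x \<in> foldr h w ` K} \<le> C"
  obtains c where "of_nat (max_cluster n \<theta>) * (ennreal ((\<rho> ^ n) powr s) * hausdorff_outer_measure s K)
    \<le> of_nat C * hausdorff_outer_measure s ({y. \<bar>proj_line \<theta> y - c\<bar> < (D + 2 * R + 1) * \<rho> ^ n} \<inter> K)"
proof -
  let ?M = "hausdorff_measure s :: (real^2) measure"
  obtain W where W: "W \<in> clusters n \<theta>" "card W = max_cluster n \<theta>"
    by (rule max_cluster_attained)
  have W_words: "w \<in> words n" if "w \<in> W" for w using that W(1) by (auto simp: clusters_def)
  have finW: "finite W" using W(1) finite_words by (auto simp: clusters_def intro: finite_subset)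
  have "W \<noteq> {}" using W(2) max_cluster_ge_1[of n \<theta>] by auto
  then obtain w0 where w0: "w0 \<in> W" by auto
  \<comment> \<open>The strip is centred at one base point of the cluster. Its half-width is
    \<open>D\<close> for the other base points, \<open>2 * R\<close> for the extent of a piece, and
    1 for the strict inequality, all times \<open>\<rho> ^ n\<close>.\<close>
  define c where "c = proj_line \<theta> (foldr h w0 p)"
  let ?T = "\<Union>w\<in>W. foldr h w ` K"
  have T_borel: "?T \<in> sets borel"
    using finW W_words borel_piece by (intro sets.finite_UN) auto
  have "?T \<subseteq> {y. \<bar>proj_line \<theta> y - c\<bar> < (D + 2 * R + 1) * \<rho> ^ n} \<inter> K"
  proof
    fix y assume "y \<in> ?T"
    then obtain w k where w: "w \<in> W" "k \<in> K" "y = foldr h w k" by auto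
    have "\<bar>proj_line \<theta> y - proj_line \<theta> (foldr h w p)\<bar> \<le> 2 * R * \<rho> ^ n"
      unfolding w(3) by (intro proj_word_piece W_words w p)
    moreover have "\<bar>proj_line \<theta> (foldr h w p) - c\<bar> \<le> D * \<rho> ^ n"
      using W(1) w(1) w0 by (auto simp: clusters_def c_def)
    moreover have "0 < \<rho> ^ n" using \<rho> by simp
    ultimately have "\<bar>proj_line \<theta> y - c\<bar> < (D + 2 * R + 1) * \<rho> ^ n"
      by (simp add: algebra_simps)
    moreover have "y \<in> K" unfolding w(3) by (intro word_in_limit_set[OF W_words] w)
    ultimately show "y \<in> {y. \<bar>proj_line \<theta> y - c\<bar> < (D + 2 * R + 1) * \<rho> ^ n} \<inter> K" by simp
  qed
  then have T_le: "hausdorff_outer_measure s ?T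
      \<le> hausdorff_outer_measure s ({y. \<bar>proj_line \<theta> y - c\<bar> < (D + 2 * R + 1) * \<rho> ^ n} \<inter> K)"
    by (rule hausdorff_outer_measure_mono)
  have "of_nat (max_cluster n \<theta>) * (ennreal ((\<rho> ^ n) powr s) * hausdorff_outer_measure s K)
      = (\<Sum>w\<in>W. hausdorff_outer_measure s (foldr h w ` K))"
    by (simp add: hausdorff_piece[OF W_words] W(2) cong: sum.cong)
  also have "\<dots> = (\<Sum>w\<in>W. emeasure ?M (foldr h w ` K))"
    using W_words borel_piece by (intro sum.cong) (auto simp: emeasure_hausdorff_measure)
  also have "\<dots> = (\<integral>\<^sup>+x. (\<Sum>w\<in>W. indicator (foldr h w ` K) x) \<partial>?M)"
    using W_words borel_piece by (subst nn_integral_sum) (auto simp: sets_hausdorff_measure)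
  also have "\<dots> \<le> (\<integral>\<^sup>+x. of_nat C * indicator ?T x \<partial>?M)"
  proof (rule nn_integral_mono)
    fix x
    have "(\<Sum>w\<in>W. indicator (foldr h w ` K) x) = (of_nat (card {w \<in> W. x \<in> foldr h w ` K}) :: ennreal)"
      using finW by (simp add: indicator_def sum.If_cases Int_def)
    also have "\<dots> \<le> of_nat C * indicator ?T x"
    proof (cases "x \<in> ?T")
      case True
      have "card {w \<in> W. x \<in> foldr h w ` K} \<le> card {w \<in> words n. x \<in> foldr h w ` K}"
        using W_words finite_words by (intro card_mono) auto
      also have "\<dots> \<le> C" by (rule C)
      finally show ?thesis using True by (simp add: of_nat_mono)
    next
      case False
      then have "{w \<in> W. x \<in> foldr h w ` K} = {}" by auto
      then show ?thesis by (simp only: card.empty) simp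
    qed
    finally show "(\<Sum>w\<in>W. indicator (foldr h w ` K) x) \<le> (of_nat C * indicator ?T x :: ennreal)" .
  qed
  also have "\<dots> = of_nat C * hausdorff_outer_measure s ?T"
    using T_borel by (simp add: nn_integral_cmult emeasure_hausdorff_measure)
  also have "\<dots> \<le> of_nat C * hausdorff_outer_measure s ({y. \<bar>proj_line \<theta> y - c\<bar> < (D + 2 * R + 1) * \<rho> ^ n} \<inter> K)"
    using T_le by (rule mult_left_mono) simp
  finally show thesis by (rule that)
qed

end

section \<open>Affine lines as fibres of projections\<close>

text \<open>The projection does not increase distances, and the distance to the fibre is attained by
  moving along the direction vector.\<close>

lemma open_neighborhood_line:
  "open_neighborhood \<epsilon> {y. proj_line \<theta> y = c} = {y. \<bar>proj_line \<theta> y - c\<bar> < \<epsilon>}"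
proof (intro equalityI subsetI)
  fix x assume "x \<in> open_neighborhood \<epsilon> {y. proj_line \<theta> y = c}"
  then obtain y where "proj_line \<theta> y = c" "dist y x < \<epsilon>" by (auto simp: open_neighborhood_def)
  then show "x \<in> {y. \<bar>proj_line \<theta> y - c\<bar> < \<epsilon>}"
    using abs_proj_line_le[of \<theta> "x - y"] by (simp add: proj_line_diff dist_norm norm_minus_commute)
next
  fix x assume x: "x \<in> {y. \<bar>proj_line \<theta> y - c\<bar> < \<epsilon>}"
  let ?u = "vector [cos \<theta>, sin \<theta>] :: real^2"
  define y where "y = x - (proj_line \<theta> x - c) *\<^sub>R ?u"
  have "?u \<bullet> ?u = 1" using norm_direction[of \<theta>] by (simp add: dot_square_norm)
  then have "proj_line \<theta> y = c"
    by (simp add: y_def proj_line_def inner_diff_left)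
  moreover have "dist y x < \<epsilon>" using x by (simp add: y_def dist_norm norm_direction)
  ultimately show "x \<in> open_neighborhood \<epsilon> {y. proj_line \<theta> y = c}"
    by (auto simp: open_neighborhood_def)
qed

lemma proj_line_fiber_affine_line: "{y. proj_line \<theta> y = c} \<in> affine_lines"
proof -
  let ?u = "vector [cos \<theta>, sin \<theta>] :: real^2"
  have eq: "{y. proj_line \<theta> y = c} = {y. ?u \<bullet> y = c}" by (simp add: proj_line_def inner_commute)
  have "?u \<noteq> 0" using norm_direction[of \<theta>] by (metis norm_zero zero_neq_one)
  then have "aff_dim {y. ?u \<bullet> y = c} = 1" by simp
  then show ?thesis unfolding eq affine_lines_def by (auto intro: affine_hyperplane)
qed

text \<open>In the plane a line is a hyperplane, and its normalised normal vector has the form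
  \<open>(cos t, sin t)\<close>.\<close>

lemma affine_line_proj_const:
  assumes "L \<in> affine_lines"
  obtains \<theta> c where "L \<subseteq> {y. proj_line \<theta> y = c}"
proof -
  have "affine L" "aff_dim L = DIM(real^2) - 1"
    using assms by (auto simp: affine_lines_def)
  then obtain a b where ab: "a \<noteq> 0" "L = {x. a \<bullet> x = b}"
    unfolding aff_dim_eq_hyperplane by (metis affine_hull_eq)
  define a1 a2 where "a1 = a $ 1 / norm a" and "a2 = a $ 2 / norm a"
  have "(norm a)\<^sup>2 = (a $ 1)\<^sup>2 + (a $ 2)\<^sup>2"
    by (simp add: norm_vec_def L2_set_def sum_2)
  then have "a1\<^sup>2 + a2\<^sup>2 = 1"
    using ab(1) unfolding a1_def a2_def power_divide add_divide_distrib[symmetric]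
    by (metis divide_self norm_eq_zero power_not_zero)
  then obtain t where t: "a1 = cos t" "a2 = sin t" by (rule sincos_total_2pi)
  have "proj_line t x = (a \<bullet> x) / norm a" for x
    unfolding proj_line_eq t[symmetric] a1_def a2_def
    by (simp add: inner_vec_def sum_2 add_divide_distrib mult.commute)
  then have "L \<subseteq> {y. proj_line t y = b / norm a}" using ab(2) by auto
  then show thesis by (rule that)
qed

section \<open>Exponents as lower limits of logarithmic ratios\<close>

lemma log_ennreal_mono:
  assumes "x \<le> y"
  shows "log_ennreal x \<le> log_ennreal y"
proof (cases "x = 0 \<or> y = top")
  case False
  then have "y \<noteq> top" "x \<noteq> top" "x \<noteq> 0" "y \<noteq> 0"
    using assms by (auto simp: top_unique)
  moreover from this have "enn2real x \<le> enn2real y" "0 < enn2real x"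
    using assms by (auto simp: enn2real_mono enn2real_positive_iff less_top zero_less_iff_neq_zero)
  ultimately show ?thesis by (simp add: log_ennreal_def)
qed (auto simp: log_ennreal_def)

lemma log_ennreal_exp: "log_ennreal (ennreal (exp t)) = ereal t"
  by (simp add: log_ennreal_def)

text \<open>A multiplicative constant in a mass estimate becomes the summand \<open>C\<close>, which
  is negligible since \<open>ln \<epsilon>\<close> tends to minus infinity.\<close>

lemma tendsto_affine_div_ln: "((\<lambda>\<epsilon>. ereal ((C + \<tau> * ln \<epsilon>) / ln \<epsilon>)) \<longlongrightarrow> ereal \<tau>) (at_right 0)"
proof -
  have "filterlim (ln :: real \<Rightarrow> real) at_infinity (at_right 0)"
    by (rule filterlim_mono[OF ln_at_0 at_bot_le_at_infinity]) simp
  then have "((\<lambda>\<epsilon>. C / ln \<epsilon>) \<longlongrightarrow> 0) (at_right 0)"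
    by (rule tendsto_divide_0[OF tendsto_const])
  then have "((\<lambda>\<epsilon>. C / ln \<epsilon> + \<tau>) \<longlongrightarrow> 0 + \<tau>) (at_right 0)"
    by (intro tendsto_add tendsto_const)
  moreover have "\<forall>\<^sub>F \<epsilon> in at_right 0. C / ln \<epsilon> + \<tau> = (C + \<tau> * ln \<epsilon>) / ln \<epsilon>"
    by (rule eventually_at_rightI[of 0 1]) (auto simp: add_divide_distrib)
  ultimately have "((\<lambda>\<epsilon>. (C + \<tau> * ln \<epsilon>) / ln \<epsilon>) \<longlongrightarrow> \<tau>) (at_right 0)"
    by (simp add: tendsto_cong)
  then show ?thesis by simp
qed

lemma ereal_divide_right_antimono:
  "x \<le> y \<Longrightarrow> c < 0 \<Longrightarrow> y / ereal c \<le> x / ereal c"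
  by (cases x; cases y) (auto simp: divide_right_mono_neg)

text \<open>Division by the negative number \<open>ln \<epsilon>\<close> reverses inequalities, so
  upper bounds for masses bound the exponent from below.\<close>

lemma exponent_ge:
  assumes "\<forall>\<^sub>F \<epsilon> in at_right 0. a \<epsilon> \<le> ennreal (exp (C + \<tau> * ln \<epsilon>))"
  shows "ereal \<tau> \<le> Liminf (at_right 0) (\<lambda>\<epsilon>. log_ennreal (a \<epsilon>) / ereal (ln \<epsilon>))"
proof -
  have "ereal \<tau> = Liminf (at_right 0) (\<lambda>\<epsilon>. ereal ((C + \<tau> * ln \<epsilon>) / ln \<epsilon>))"
    by (rule lim_imp_Liminf[OF _ tendsto_affine_div_ln, symmetric]) simp
  also have "\<dots> \<le> Liminf (at_right 0) (\<lambda>\<epsilon>. log_ennreal (a \<epsilon>) / ereal (ln \<epsilon>))"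
  proof (rule Liminf_mono)
    have "\<forall>\<^sub>F \<epsilon> in at_right 0. 0 < \<epsilon> \<and> \<epsilon> < (1::real)"
      by (rule eventually_at_rightI[of 0 1]) auto
    with assms show "\<forall>\<^sub>F \<epsilon> in at_right 0. ereal ((C + \<tau> * ln \<epsilon>) / ln \<epsilon>) \<le> log_ennreal (a \<epsilon>) / ereal (ln \<epsilon>)"
    proof eventually_elim
      case (elim \<epsilon>)
      have "log_ennreal (a \<epsilon>) \<le> ereal (C + \<tau> * ln \<epsilon>)"
        using log_ennreal_mono[OF elim(1)] by (simp only: log_ennreal_exp)
      moreover have "ln \<epsilon> < 0" using elim(2) by simp
      ultimately show ?case
        using ereal_divide_right_antimono[of _ "ereal (C + \<tau> * ln \<epsilon>)"] by fastforce
    qed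
  qed
  finally show ?thesis .
qed

text \<open>The exponent is a lower limit, so a lower bound for the mass at arbitrarily small scales
  is enough.\<close>

lemma exponent_le:
  assumes "\<exists>\<^sub>F \<epsilon> in at_right 0. ennreal (exp (C + \<tau> * ln \<epsilon>)) \<le> a \<epsilon>"
  shows "Liminf (at_right 0) (\<lambda>\<epsilon>. log_ennreal (a \<epsilon>) / ereal (ln \<epsilon>)) \<le> ereal \<tau>"
proof (rule ccontr)
  assume "\<not> ?thesis"
  then obtain y where y: "ereal \<tau> < y" "y < Liminf (at_right 0) (\<lambda>\<epsilon>. log_ennreal (a \<epsilon>) / ereal (ln \<epsilon>))"
    using dense[of "ereal \<tau>"] by (auto simp: not_le)
  have "\<forall>\<^sub>F \<epsilon> in at_right 0. 0 < \<epsilon> \<and> \<epsilon> < (1::real)"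
    by (rule eventually_at_rightI[of 0 1]) auto
  moreover have "\<forall>\<^sub>F \<epsilon> in at_right 0. ereal ((C + \<tau> * ln \<epsilon>) / ln \<epsilon>) < y"
    by (rule order_tendstoD(2)[OF tendsto_affine_div_ln y(1)])
  moreover have "\<forall>\<^sub>F \<epsilon> in at_right 0. y < log_ennreal (a \<epsilon>) / ereal (ln \<epsilon>)"
    by (rule less_LiminfD[OF y(2)])
  ultimately have "\<forall>\<^sub>F \<epsilon> in at_right 0. \<not> ennreal (exp (C + \<tau> * ln \<epsilon>)) \<le> a \<epsilon>"
  proof eventually_elim
    case (elim \<epsilon>)
    show ?case
    proof
      assume "ennreal (exp (C + \<tau> * ln \<epsilon>)) \<le> a \<epsilon>"
      then have "ereal (C + \<tau> * ln \<epsilon>) \<le> log_ennreal (a \<epsilon>)"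
        using log_ennreal_mono[of "ennreal (exp (C + \<tau> * ln \<epsilon>))"] by (simp only: log_ennreal_exp)
      moreover have "ln \<epsilon> < 0" using elim(1) by simp
      ultimately have "log_ennreal (a \<epsilon>) / ereal (ln \<epsilon>) \<le> ereal ((C + \<tau> * ln \<epsilon>) / ln \<epsilon>)"
        using ereal_divide_right_antimono[of "ereal (C + \<tau> * ln \<epsilon>)"] by fastforce
      then show False using elim by auto
    qed
  qed
  then show False using assms by (simp add: frequently_def)
qed

section \<open>Comparison of the exponents\<close>

lemma borel_measurable_proj_line [measurable]: "proj_line \<theta> \<in> borel_measurable borel"
  unfolding proj_line_def by measurable

lemma emeasure_distr_proj_line:
  assumes "sets \<mu> = sets borel"
  shows "emeasure (distr \<mu> borel (proj_line \<theta>)) (ball x \<epsilon>) = emeasure \<mu> {y. \<bar>proj_line \<theta> y - x\<bar> < \<epsilon>}"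
proof -
  have "proj_line \<theta> \<in> measurable \<mu> borel"
    using assms borel_measurable_proj_line by (simp cong: measurable_cong_sets)
  moreover have "proj_line \<theta> -` ball x \<epsilon> \<inter> space \<mu> = {y. \<bar>proj_line \<theta> y - x\<bar> < \<epsilon>}"
    using sets_eq_imp_space_eq[OF assms] by (auto simp: dist_real_def abs_minus_commute)
  ultimately show ?thesis by (simp add: emeasure_distr)
qed

lemma SUP_strip_le_SUP_line:
  assumes "sets \<mu> = sets borel"
  shows "(SUP x. emeasure (distr \<mu> borel (proj_line \<theta>)) (ball x \<epsilon>))
    \<le> (SUP L\<in>affine_lines. emeasure \<mu> (open_neighborhood \<epsilon> L))"
proof (rule SUP_least)
  fix x
  show "emeasure (distr \<mu> borel (proj_line \<theta>)) (ball x \<epsilon>)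
      \<le> (SUP L\<in>affine_lines. emeasure \<mu> (open_neighborhood \<epsilon> L))"
    unfolding emeasure_distr_proj_line[OF assms] open_neighborhood_line[symmetric]
    by (rule SUP_upper[OF proj_line_fiber_affine_line])
qed

text \<open>Strips orthogonal to one direction are among the neighbourhoods of lines, and the
  smaller supremum yields the larger exponent. This holds for every direction.\<close>

lemma line_exponent_le_frostman_exponent:
  assumes "sets \<mu> = sets borel"
  shows "line_exponent \<mu> \<le> frostman_exponent (distr \<mu> borel (proj_line \<theta>))"
  unfolding line_exponent_def frostman_exponent_def
proof (rule Liminf_mono)
  have "\<forall>\<^sub>F \<epsilon> in at_right 0. 0 < \<epsilon> \<and> \<epsilon> < (1::real)"
    by (rule eventually_at_rightI[of 0 1]) auto
  then show "\<forall>\<^sub>F \<epsilon> in at_right 0.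
      log_ennreal (SUP L\<in>affine_lines. emeasure \<mu> (open_neighborhood \<epsilon> L)) / ereal (ln \<epsilon>)
      \<le> log_ennreal (SUP x. emeasure (distr \<mu> borel (proj_line \<theta>)) (ball x \<epsilon>)) / ereal (ln \<epsilon>)"
    by eventually_elim
      (auto intro!: ereal_divide_right_antimono log_ennreal_mono SUP_strip_le_SUP_line assms)
qed

lemma emeasure_open_neighborhood_density:
  assumes "K \<in> sets borel" and \<mu>: "\<mu> = density (hausdorff_measure s) (indicator K)"
  shows "emeasure \<mu> (open_neighborhood \<epsilon> L) = hausdorff_outer_measure s (open_neighborhood \<epsilon> L \<inter> K)"
proof -
  have "open (open_neighborhood \<epsilon> L)" by (auto simp: open_neighborhood_def)
  then have "open_neighborhood \<epsilon> L \<in> sets borel" by (rule borel_open)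
  then show ?thesis
    unfolding \<mu> using assms(1)
    by (simp add: emeasure_restricted emeasure_hausdorff_measure Int_commute)
qed

text \<open>The integer part of \<open>ln \<epsilon> / ln \<rho>\<close> gives
  \<open>\<rho> ^ (n + 1) \<le> \<epsilon> \<le> \<rho> ^ n\<close>. Estimates at the scales
  \<open>\<rho> ^ n\<close> thus transfer to all \<open>\<epsilon>\<close> at the cost of a
  constant.\<close>

lemma power_scale_approx:
  fixes \<rho> \<epsilon> :: real
  assumes \<rho>: "0 < \<rho>" "\<rho> < 1" and \<epsilon>: "0 < \<epsilon>" "\<epsilon> < \<rho> ^ n0"
  obtains n where "n0 \<le> n" "\<epsilon> \<le> \<rho> ^ n" "real n * ln \<rho> \<le> ln \<epsilon> - ln \<rho>" "ln \<epsilon> \<le> real n * ln \<rho>"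
proof -
  have l: "ln \<rho> < 0" using \<rho> by simp
  have "ln \<epsilon> < ln (\<rho> ^ n0)" using \<epsilon> \<rho> by (subst ln_less_cancel_iff) auto
  then have n0: "real n0 < ln \<epsilon> / ln \<rho>" using \<rho> l by (simp add: ln_realpow neg_less_divide_eq)
  define n where "n = nat \<lfloor>ln \<epsilon> / ln \<rho>\<rfloor>"
  have "0 \<le> ln \<epsilon> / ln \<rho>" using n0 by linarith
  then have n: "real n \<le> ln \<epsilon> / ln \<rho>" "ln \<epsilon> / ln \<rho> \<le> real n + 1"
    unfolding n_def by (auto simp: of_nat_nat)
  have ge: "ln \<epsilon> \<le> real n * ln \<rho>" using n(1) l by (simp add: neg_le_divide_eq)
  have "real n * ln \<rho> \<le> ln \<epsilon> - ln \<rho>" using n(2) l by (simp add: neg_divide_le_eq algebra_simps)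
  moreover have "n0 \<le> n" using n0 n(2) by linarith
  moreover have "\<epsilon> \<le> \<rho> ^ n"
  proof -
    have "ln \<epsilon> \<le> ln (\<rho> ^ n)" using ge \<rho> by (simp add: ln_realpow)
    then show ?thesis using \<epsilon> \<rho> by (subst (asm) ln_le_cancel_iff) auto
  qed
  ultimately show thesis using ge by (intro that)
qed

text \<open>Both sides are compared with one number \<open>\<tau>\<close>. The uniform upper rate
  \<open>\<gamma>\<close> makes all strips small at all small scales, so the line exponent is at
  least \<open>\<tau>\<close>. For almost every direction some strip is large at infinitely many
  scales, so the Frostman exponent is at most \<open>\<tau>\<close>.\<close>

lemma (in planar_ifs) frostman_exponent_le_line_exponent:
  assumes irr: "irrational_angle \<alpha>" and osc: "open_set_condition \<Lambda> h"
    and \<mu>: "\<mu> = density (hausdorff_measure s) (indicator K)"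
    and \<kappa>: "hausdorff_outer_measure s K = ennreal \<kappa>" "0 < \<kappa>"
  shows "AE \<theta> in lborel. \<theta> \<in> {0..<pi} \<longrightarrow>
    frostman_exponent (distr \<mu> borel (proj_line \<theta>)) \<le> line_exponent \<mu>"
proof -
  define f where "f n \<theta> = ln (real (max_cluster n \<theta>))" for n \<theta>
  have Z1: "1 \<le> real (max_cluster n \<theta>)" for n \<theta>
    using max_cluster_ge_1[of n \<theta>] by simp
  have exp_f: "exp (f n \<theta>) = real (max_cluster n \<theta>)" for n \<theta>
    using Z1[of n \<theta>] by (simp add: f_def)
  have K_borel: "K \<in> sets borel" using lim by (auto simp: is_limit_set_def intro: borel_compact)
  have sets_\<mu>: "sets \<mu> = sets borel" by (simp add: \<mu>)
  have irr_pi: "\<alpha> / pi \<notin> \<rat>"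
  proof
    assume "\<alpha> / pi \<in> \<rat>"
    then have "\<alpha> \<in> (\<lambda>q. q * pi) ` \<rat>" by (intro image_eqI[of _ _ "\<alpha> / pi"]) auto
    then show False using irr by (simp add: irrational_angle_def)
  qed
  have meas: "f n \<in> borel_measurable borel" for n
    unfolding f_def by (intro borel_measurable_ln max_cluster_measurable)
  have nonneg: "0 \<le> f n \<theta>" for n \<theta> using Z1[of n \<theta>] by (simp add: f_def)
  have le: "f n \<theta> \<le> ln (real (card \<Lambda>)) * real n" for n \<theta>
  proof -
    have "f n \<theta> \<le> ln (real (card \<Lambda> ^ n))"
      unfolding f_def using max_cluster_le[of n \<theta>] Z1[of n \<theta>] by (intro ln_mono of_nat_mono) auto
    also have "\<dots> = ln (real (card \<Lambda>)) * real n"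
      using finite_\<Lambda> \<Lambda>_nonempty by (simp add: ln_realpow card_gt_0_iff)
    finally show ?thesis .
  qed
  have per: "f n (\<theta> + pi) = f n \<theta>" for n \<theta> by (simp add: f_def max_cluster_periodic)
  have sub: "f (m + n) \<theta> \<le> f m \<theta> + f n (\<theta> - real m * \<alpha>)" for m n \<theta>
  proof -
    have "exp (f (m + n) \<theta>) \<le> exp (f m \<theta> + f n (\<theta> - real m * \<alpha>))"
      unfolding exp_add exp_f of_nat_mult[symmetric] of_nat_le_iff by (rule max_cluster_submult)
    then show ?thesis by simp
  qed
  have cont: "\<exists>\<delta>>0. \<forall>x y. \<bar>x - y\<bar> < \<delta> \<longrightarrow> f n x \<le> f n y + ln 2" for n
  proof -
    obtain \<delta> where \<delta>: "\<delta> > 0" "\<And>x y. \<bar>x - y\<bar> < \<delta> \<Longrightarrow> max_cluster n x \<le> 2 * max_cluster n y"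
      using max_cluster_coarsely_continuous by blast
    have "f n x \<le> f n y + ln 2" if "\<bar>x - y\<bar> < \<delta>" for x y
    proof -
      have "real (max_cluster n x) \<le> real (2 * max_cluster n y)"
        using \<delta>(2)[OF that] by (rule of_nat_mono)
      then have "exp (f n x) \<le> exp (f n y + ln 2)" unfolding exp_add exp_f by simp
      then show ?thesis by simp
    qed
    then show ?thesis using \<delta>(1) by blast
  qed
  obtain \<gamma> where
    upper: "\<And>\<delta>. 0 < \<delta> \<Longrightarrow> \<exists>n0. \<forall>n\<ge>n0. \<forall>x. f n x \<le> (\<gamma> + \<delta>) * real n"
    and lower: "AE x in lborel. x \<in> {0..<pi} \<longrightarrow>
      (\<forall>\<delta>>0. \<exists>\<^sub>F n in sequentially. (\<gamma> - \<delta>) * real n \<le> f n x)"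
    by (rule subadditive_cocycle_irrational_rotation[OF meas nonneg le per pi_gt_zero irr_pi sub
      ln_ge_zero[OF one_le_numeral] cont]) (rule that)
  \<comment> \<open>Chosen so that the typical strip mass \<open>\<rho> ^ n\<close> to the power
    \<open>s\<close>, times \<open>exp (\<gamma> * n)\<close>, equals \<open>\<rho> ^ n\<close> to
    the power \<open>\<tau>\<close>.\<close>
  define \<tau> where "\<tau> = s + \<gamma> / ln \<rho>"
  have ln\<rho>: "ln \<rho> < 0" using \<rho> by simp
  have mass: "of_nat (max_cluster n \<theta>) * (ennreal ((\<rho> ^ n) powr s) * hausdorff_outer_measure s K)
      = ennreal (exp (f n \<theta> + s * (real n * ln \<rho>) + ln \<kappa>))" for n \<theta>
  proof -
    have "(\<rho> ^ n) powr s = exp (s * (real n * ln \<rho>))"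
      using \<rho> by (simp add: powr_def ln_realpow)
    then show ?thesis
      unfolding \<kappa>(1) exp_add exp_f using \<kappa>(2)
      by (simp add: ennreal_mult' mult.assoc ennreal_of_nat_eq_real_of_nat)
  qed
  have line_ge: "ereal (\<tau> - \<delta>) \<le> line_exponent \<mu>" if \<delta>: "0 < \<delta>" for \<delta>
    unfolding line_exponent_def
  proof (rule exponent_ge)
    \<comment> \<open>Since \<open>ln \<rho> < 0\<close>, the slack
      \<open>- (\<delta> * ln \<rho>)\<close> is positive; it lowers the exponent
      \<open>\<tau>\<close> by exactly \<open>\<delta>\<close>.\<close>
    obtain n0 where n0: "\<And>n \<theta>. n \<ge> n0 \<Longrightarrow> f n \<theta> \<le> (\<gamma> + - (\<delta> * ln \<rho>)) * real n"
      using upper[of "- (\<delta> * ln \<rho>)"] \<delta> ln\<rho> by (auto simp: mult_less_0_iff)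
    \<comment> \<open>The second summand absorbs the replacement of \<open>n * ln \<rho>\<close> by
      \<open>ln \<epsilon>\<close>: their difference lies between 0 and
      \<open>- ln \<rho>\<close>.\<close>
    let ?C = "ln \<kappa> + \<bar>\<tau> - \<delta>\<bar> * (- ln \<rho>)"
    show "\<forall>\<^sub>F \<epsilon> in at_right 0. (SUP L\<in>affine_lines. emeasure \<mu> (open_neighborhood \<epsilon> L))
        \<le> ennreal (exp (?C + (\<tau> - \<delta>) * ln \<epsilon>))"
    proof (rule eventually_at_rightI[of 0 "\<rho> ^ n0"])
      show "0 < \<rho> ^ n0" using \<rho> by simp
      fix \<epsilon> assume "\<epsilon> \<in> {0<..<\<rho> ^ n0}"
      then obtain n where n: "n0 \<le> n" "\<epsilon> \<le> \<rho> ^ n"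
        "real n * ln \<rho> \<le> ln \<epsilon> - ln \<rho>" "ln \<epsilon> \<le> real n * ln \<rho>"
        using power_scale_approx[OF \<rho>, of \<epsilon> n0] by auto
      show "(SUP L\<in>affine_lines. emeasure \<mu> (open_neighborhood \<epsilon> L))
          \<le> ennreal (exp (?C + (\<tau> - \<delta>) * ln \<epsilon>))"
      proof (rule SUP_least)
        fix L assume "L \<in> affine_lines"
        then obtain \<theta> c where L: "L \<subseteq> {y. proj_line \<theta> y = c}" by (rule affine_line_proj_const)
        have "open_neighborhood \<epsilon> L \<subseteq> open_neighborhood \<epsilon> {y. proj_line \<theta> y = c}"
          using L by (auto simp: open_neighborhood_def)
        then have strip: "\<bar>proj_line \<theta> x - c\<bar> \<le> \<rho> ^ n" if "x \<in> open_neighborhood \<epsilon> L" for x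
          using that n(2) unfolding open_neighborhood_line by fastforce
        have "emeasure \<mu> (open_neighborhood \<epsilon> L) \<le> ennreal (exp (f n \<theta> + s * (real n * ln \<rho>) + ln \<kappa>))"
          unfolding emeasure_open_neighborhood_density[OF K_borel \<mu>] mass[symmetric]
          by (rule hausdorff_strip_le[OF strip])
        also have "\<dots> \<le> ennreal (exp (?C + (\<tau> - \<delta>) * ln \<epsilon>))"
        proof (rule ennreal_leI, subst exp_le_cancel_iff)
          have "f n \<theta> + s * (real n * ln \<rho>) \<le> (\<gamma> + - (\<delta> * ln \<rho>)) * real n + s * (real n * ln \<rho>)"
            using n0[OF n(1)] by simp
          also have "\<dots> = (\<tau> - \<delta>) * (real n * ln \<rho>)"
            using ln\<rho> by (simp add: \<tau>_def field_simps)
          also have "\<dots> = (\<tau> - \<delta>) * ln \<epsilon> + (\<tau> - \<delta>) * (real n * ln \<rho> - ln \<epsilon>)"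
            by (simp add: algebra_simps)
          also have "(\<tau> - \<delta>) * (real n * ln \<rho> - ln \<epsilon>) \<le> \<bar>\<tau> - \<delta>\<bar> * (- ln \<rho>)"
            using n(3,4) by (intro mult_mono) auto
          finally show "f n \<theta> + s * (real n * ln \<rho>) + ln \<kappa> \<le> ?C + (\<tau> - \<delta>) * ln \<epsilon>" by simp
        qed
        finally show "emeasure \<mu> (open_neighborhood \<epsilon> L) \<le> ennreal (exp (?C + (\<tau> - \<delta>) * ln \<epsilon>))" .
      qed
    qed
  qed
  obtain C :: nat where C: "0 < C" "\<And>n x. card {w \<in> words n. x \<in> foldr h w ` K} \<le> C"
    using bounded_overlap[OF osc] by blast
  define E where "E = D + 2 * R + 1"
  have E: "0 < E" using D_pos R(2) by (simp add: E_def)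
  from lower show ?thesis
  proof eventually_elim
    case (elim \<theta>)
    show ?case
    proof
      assume \<theta>: "\<theta> \<in> {0..<pi}"
      have "frostman_exponent (distr \<mu> borel (proj_line \<theta>)) \<le> ereal (\<tau> + \<delta>)" if \<delta>: "0 < \<delta>" for \<delta>
        unfolding frostman_exponent_def
      proof (rule exponent_le)
        \<comment> \<open>The constant collects the total mass, the overlap bound \<open>C\<close>
          and the factor \<open>E\<close> between the scales \<open>\<rho> ^ n\<close> and the
          half-widths \<open>E * \<rho> ^ n\<close>.\<close>
        let ?C = "ln \<kappa> - ln (real C) - (\<tau> + \<delta>) * ln E"
        let ?P = "\<lambda>\<epsilon>. ennreal (exp (?C + (\<tau> + \<delta>) * ln \<epsilon>))
            \<le> (SUP x. emeasure (distr \<mu> borel (proj_line \<theta>)) (ball x \<epsilon>))"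
        have "\<exists>\<^sub>F n in sequentially. (\<gamma> - - (\<delta> * ln \<rho>)) * real n \<le> f n \<theta>"
          using elim[rule_format, OF \<theta>, of "- (\<delta> * ln \<rho>)"] mult_pos_neg[OF \<delta> ln\<rho>] by simp
        then have "\<exists>\<^sub>F n in sequentially. ?P (E * \<rho> ^ n)"
        proof (rule frequently_elim1)
          fix n assume n: "(\<gamma> - - (\<delta> * ln \<rho>)) * real n \<le> f n \<theta>"
          obtain c where c: "of_nat (max_cluster n \<theta>) * (ennreal ((\<rho> ^ n) powr s) * hausdorff_outer_measure s K)
              \<le> of_nat C * hausdorff_outer_measure s ({y. \<bar>proj_line \<theta> y - c\<bar> < E * \<rho> ^ n} \<inter> K)"
            using hausdorff_strip_ge[OF C(2)] unfolding E_def by blast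
          have strip: "hausdorff_outer_measure s ({y. \<bar>proj_line \<theta> y - c\<bar> < E * \<rho> ^ n} \<inter> K)
              = emeasure (distr \<mu> borel (proj_line \<theta>)) (ball c (E * \<rho> ^ n))"
            unfolding emeasure_distr_proj_line[OF sets_\<mu>] open_neighborhood_line[symmetric]
            by (rule emeasure_open_neighborhood_density[OF K_borel \<mu>, symmetric])
          have "?C + (\<tau> + \<delta>) * ln (E * \<rho> ^ n) = (\<tau> + \<delta>) * (real n * ln \<rho>) + ln \<kappa> - ln (real C)"
            using E \<rho> by (simp add: ln_mult ln_realpow algebra_simps)
          also have "(\<tau> + \<delta>) * (real n * ln \<rho>) = (\<gamma> - - (\<delta> * ln \<rho>)) * real n + s * (real n * ln \<rho>)"
            using ln\<rho> by (simp add: \<tau>_def field_simps)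
          finally have exponent: "?C + (\<tau> + \<delta>) * ln (E * \<rho> ^ n)
              \<le> (f n \<theta> + s * (real n * ln \<rho>) + ln \<kappa>) - ln (real C)"
            using n by linarith
          have "ennreal (exp (?C + (\<tau> + \<delta>) * ln (E * \<rho> ^ n)))
              \<le> ennreal (exp ((f n \<theta> + s * (real n * ln \<rho>) + ln \<kappa>) - ln (real C)))"
            using exponent by (intro ennreal_leI) simp
          also have "\<dots> = ennreal (1 / real C) * ennreal (exp (f n \<theta> + s * (real n * ln \<rho>) + ln \<kappa>))"
            using C(1) by (simp add: exp_diff flip: ennreal_mult')
          also have "\<dots> \<le> ennreal (1 / real C) * (of_nat C * emeasure (distr \<mu> borel (proj_line \<theta>)) (ball c (E * \<rho> ^ n)))"
            using c unfolding mass strip by (rule mult_left_mono) simp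
          also have "\<dots> = emeasure (distr \<mu> borel (proj_line \<theta>)) (ball c (E * \<rho> ^ n))"
            using C(1) by (simp add: mult.assoc[symmetric] ennreal_of_nat_eq_real_of_nat flip: ennreal_mult')
          also have "\<dots> \<le> (SUP x. emeasure (distr \<mu> borel (proj_line \<theta>)) (ball x (E * \<rho> ^ n)))"
            by (rule SUP_upper) simp
          finally show "?P (E * \<rho> ^ n)" .
        qed
        \<comment> \<open>These scales tend to 0 from the right, so infinitely many good
          \<open>n\<close> give good \<open>\<epsilon>\<close> arbitrarily close to 0.\<close>
        moreover have "filterlim (\<lambda>n. E * \<rho> ^ n) (at_right 0) sequentially"
        proof (rule tendsto_imp_filterlim_at_right)
          have "(\<lambda>n. E * \<rho> ^ n) \<longlonglongrightarrow> E * 0"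
            using \<rho> by (intro tendsto_mult tendsto_const LIMSEQ_realpow_zero) auto
          then show "(\<lambda>n. E * \<rho> ^ n) \<longlonglongrightarrow> 0" by simp
          show "\<forall>\<^sub>F n in sequentially. 0 < E * \<rho> ^ n" using E \<rho> by simp
        qed
        ultimately show "\<exists>\<^sub>F \<epsilon> in at_right 0. ?P \<epsilon>"
          unfolding frequently_def using eventually_compose_filterlim by blast
      qed
      note frostman_le = this
      show "frostman_exponent (distr \<mu> borel (proj_line \<theta>)) \<le> line_exponent \<mu>"
      proof (rule ereal_le_epsilon2)
        fix e :: real assume e: "0 < e"
        have "frostman_exponent (distr \<mu> borel (proj_line \<theta>)) \<le> ereal (\<tau> + e / 2)"
          using e by (intro frostman_le) simp
        also have "\<dots> = ereal (\<tau> - e / 2) + ereal e" by simp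
        also have "\<dots> \<le> line_exponent \<mu> + ereal e"
          using e by (intro add_right_mono line_ge) simp
        finally show "frostman_exponent (distr \<mu> borel (proj_line \<theta>)) \<le> line_exponent \<mu> + ereal e" .
      qed
    qed
  qed
qed

section \<open>Infinite mass, and equality of the exponents\<close>

text \<open>Finitely many strips of any given width cover the compact set, so one of them has
  infinite mass. Both suprema are then \<open>top\<close> at every scale.\<close>

lemma frostman_exponent_eq_line_exponent_infinite:
  assumes K: "compact K" and top: "emeasure \<mu> K = top" and \<mu>: "sets \<mu> = sets borel"
  shows "frostman_exponent (distr \<mu> borel (proj_line \<theta>)) = line_exponent \<mu>"
proof -
  have sup_top: "(SUP x. emeasure (distr \<mu> borel (proj_line \<theta>)) (ball x \<epsilon>)) = top" if \<epsilon>: "0 < \<epsilon>" for \<epsilon>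
  proof (rule ccontr)
    assume "\<not> ?thesis"
    then have "(SUP x. emeasure (distr \<mu> borel (proj_line \<theta>)) (ball x \<epsilon>)) < top"
      by (rule top.not_eq_extremum[THEN iffD1])
    then have fin: "emeasure \<mu> (open_neighborhood \<epsilon> {y. proj_line \<theta> y = x}) < top" for x
      unfolding open_neighborhood_line emeasure_distr_proj_line[OF \<mu>, symmetric]
      by (rule le_less_trans[OF SUP_upper[OF UNIV_I]])
    have opn: "open (open_neighborhood \<epsilon> {y. proj_line \<theta> y = x})" for x
      by (auto simp: open_neighborhood_def)
    obtain X where X: "finite X" "K \<subseteq> (\<Union>x\<in>X. open_neighborhood \<epsilon> {y. proj_line \<theta> y = x})"
    proof (rule compactE_image[OF K, of UNIV "\<lambda>x. open_neighborhood \<epsilon> {y. proj_line \<theta> y = x}"])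
      show "K \<subseteq> (\<Union>x. open_neighborhood \<epsilon> {y. proj_line \<theta> y = x})"
      proof
        fix x
        have "x \<in> open_neighborhood \<epsilon> {y. proj_line \<theta> y = proj_line \<theta> x}"
          using \<epsilon> by (simp add: open_neighborhood_line)
        then show "x \<in> (\<Union>c. open_neighborhood \<epsilon> {y. proj_line \<theta> y = c})" by blast
      qed
    qed (use opn in auto)
    have "emeasure \<mu> K \<le> emeasure \<mu> (\<Union>x\<in>X. open_neighborhood \<epsilon> {y. proj_line \<theta> y = x})"
      using X opn \<mu> by (intro emeasure_mono) auto
    also have "\<dots> \<le> (\<Sum>x\<in>X. emeasure \<mu> (open_neighborhood \<epsilon> {y. proj_line \<theta> y = x}))"
      using X(1) opn \<mu> by (intro emeasure_subadditive_finite) auto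
    also have "\<dots> < top" using fin X(1) by (simp add: less_top[symmetric])
    finally show False using top by simp
  qed
  have eq: "(SUP x. emeasure (distr \<mu> borel (proj_line \<theta>)) (ball x \<epsilon>))
      = (SUP L\<in>affine_lines. emeasure \<mu> (open_neighborhood \<epsilon> L))" if "0 < \<epsilon>" for \<epsilon>
    using SUP_strip_le_SUP_line[OF \<mu>, of \<theta> \<epsilon>] sup_top[OF that] by (metis top_unique)
  show ?thesis
    unfolding frostman_exponent_def line_exponent_def
    by (rule Liminf_eq, rule eventually_at_rightI[of 0 1]) (simp_all add: eq)
qed

theorem theorem1p9:
  fixes \<Lambda> :: "'i set" and h :: "'i \<Rightarrow> real^2 \<Rightarrow> real^2" and \<rho> \<alpha> s :: real
    and K :: "(real^2) set" and \<mu> :: "(real^2) measure"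
  assumes "homogeneous_ifs \<rho> \<alpha> \<Lambda> h"
    and "irrational_angle \<alpha>"
    and "open_set_condition \<Lambda> h"
    and "is_limit_set \<Lambda> h K"
    and "s = hausdorff_dim K"
    and "\<mu> = density (hausdorff_measure s) (indicator K)"
  shows "AE \<theta> in lebesgue_on {0..<pi}.
           line_exponent \<mu> = (INF \<beta>\<in>{0..<pi}. frostman_exponent (distr \<mu> borel (proj_line \<beta>))) \<and>
           (INF \<beta>\<in>{0..<pi}. frostman_exponent (distr \<mu> borel (proj_line \<beta>)))
             = frostman_exponent (distr \<mu> borel (proj_line \<theta>))"
proof -
  note \<mu> = assms(6)
  have K: "compact K" "K \<noteq> {}" using assms(4) by (auto simp: is_limit_set_def)
  have K_borel: "K \<in> sets borel" using K(1) by (rule borel_compact)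
  have sets_\<mu>: "sets \<mu> = sets borel" by (simp add: \<mu>)
  have emeasure_\<mu>: "emeasure \<mu> A = hausdorff_outer_measure s (A \<inter> K)" if "A \<in> sets borel" for A
    unfolding \<mu> using that K_borel
    by (simp add: emeasure_restricted emeasure_hausdorff_measure Int_commute)
  have "AE \<theta> in lborel. \<theta> \<in> {0..<pi} \<longrightarrow>
      frostman_exponent (distr \<mu> borel (proj_line \<theta>)) \<le> line_exponent \<mu>"
  \<comment> \<open>For zero or infinite mass the two exponents agree for every direction; only
    positive finite mass involves the cocycle.\<close>
  proof (cases "hausdorff_outer_measure s K")
    case (real \<kappa>)
    show ?thesis
    proof (cases "\<kappa> = 0")
      case True
      have "emeasure \<mu> A = 0" if "A \<in> sets borel" for A
        using emeasure_\<mu>[OF that] hausdorff_outer_measure_mono[of "A \<inter> K" K s] real True by simp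
      moreover have "open (open_neighborhood \<epsilon> L)" for \<epsilon> and L :: "(real^2) set"
        by (auto simp: open_neighborhood_def)
      ultimately have null: "emeasure \<mu> (open_neighborhood \<epsilon> L) = 0" for \<epsilon> L
        by (simp add: borel_open)
      have "affine_lines \<noteq> {}" using proj_line_fiber_affine_line by blast
      then have "frostman_exponent (distr \<mu> borel (proj_line \<theta>)) = line_exponent \<mu>" for \<theta>
        unfolding frostman_exponent_def line_exponent_def emeasure_distr_proj_line[OF sets_\<mu>]
          open_neighborhood_line[symmetric] null by simp
      then show ?thesis by simp
    next
      case False
      obtain p where p: "p \<in> K" using K(2) by blast
      obtain R where R: "0 < R" "\<And>x. x \<in> K \<Longrightarrow> norm x \<le> R"
        using compact_imp_bounded[OF K(1)] by (auto simp: bounded_pos)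
      have "\<rho> < 1" using assms(1) by (simp add: homogeneous_ifs_def)
      \<comment> \<open>This width constant turns the condition
        \<open>2 + 4 * R \<le> (1 - \<rho>) * D\<close> into an equality.\<close>
      then interpret planar_ifs \<Lambda> h \<rho> \<alpha> R "(2 + 4 * R) / (1 - \<rho>)" K p
        using assms p R by unfold_locales auto
      show ?thesis
        using frostman_exponent_le_line_exponent[OF assms(2,3) \<mu> real(2)] real False by simp
    qed
  next
    case top
    then have "emeasure \<mu> K = top" using emeasure_\<mu>[OF K_borel] by simp
    then show ?thesis
      using frostman_exponent_eq_line_exponent_infinite[OF K(1) _ sets_\<mu>] by simp
  qed
  then have "AE \<theta> in lebesgue. \<theta> \<in> {0..<pi} \<longrightarrow>
      frostman_exponent (distr \<mu> borel (proj_line \<theta>)) \<le> line_exponent \<mu>"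
    by (rule AE_completion)
  then have "AE \<theta> in lebesgue_on {0..<pi}.
      \<theta> \<in> {0..<pi} \<and> frostman_exponent (distr \<mu> borel (proj_line \<theta>)) \<le> line_exponent \<mu>"
    by (subst AE_restrict_space_iff) auto
  then show ?thesis
  \<comment> \<open>The chain line exponent, infimum, Frostman exponent at \<open>\<theta>\<close>
    is increasing for every \<open>\<theta>\<close> in the period; the almost sure inequality closes
    it to a cycle.\<close>
  proof eventually_elim
    case (elim \<theta>)
    let ?I = "INF \<beta>\<in>{0..<pi}. frostman_exponent (distr \<mu> borel (proj_line \<beta>))"
    have "line_exponent \<mu> \<le> ?I"
      by (intro INF_greatest line_exponent_le_frostman_exponent sets_\<mu>)
    moreover have "?I \<le> frostman_exponent (distr \<mu> borel (proj_line \<theta>))"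
      using elim by (intro INF_lower) simp
    ultimately show ?case using elim by auto
  qed
qed

end
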